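(* Let $p\ge 1$ and suppose the diagram $D$ contains $\delta_p \cdot (1)$ as a subdiagram in rows $1, \ldots, p$ and columns $1, \ldots, p$. Then there is a filtration $$0 = M_0 \subseteq M_1 \subseteq \cdots \subseteq M_p = S^D$$ of $S^D$ by $S_{|D|}$-submodules such that for each $1 \leq j \leq p$, there is a surjection of $S_{|D|}$-modules $$M_j / M_{j-1} \twoheadrightarrow S^{R_{p\to p-j+1}C_{p\to j}D}.$$
   Context: A diagram is a finite subset $D$ of $\mathbb{N}\times\mathbb{N}$ with $\mathbb{N}=\{1,2,\dots\}$; its elements $(i,j)$ (row $i$, column $j$) are called cells. A filling of $D$ is a bijection $T:D\to\{1,\dots,|D|\}$. $S_{|D|}$ acts on fillings by permuting entries. The row group $\mathbf{R}(T)\le S_{|D|}$ (column group $\mathbf{C}(T)$) consists of the permutations acting on $T$ by permuting entries within their rows (columns). The Young symmetrizer is $y_T=\sum_{p\in \mathbf{R}(T)}\sum_{q\in \mathbf{C}(T)}\mathrm{sgn}(q)\,qp\in\mathbb{C}[S_{|D|}]$. The (generalized) Specht module of $D$ is the left ideal $S^D=\mathbb{C}[S_{|D|}]\,y_T$; its isomorphism type does not depend on $T$. James-Peel moves: $R_{a\to b}D$ is obtained from $D$ by moving each cell $(a,j)$ of row $a$ to $(b,j)$ whenever $(b,j)\notin D$, leaving all other cells in place; $C_{c\to d}D$ is obtained by moving each cell $(i,c)$ of column $c$ to $(i,d)$ whenever $(i,d)\notin D$. In particular $R_{a\to a}D=C_{c\to c}D=D$. In a composite the rightmost move is applied first. $\delta_p=(p-1,p-2,\dots,1)$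 is the staircase partition, and $\delta_p\cdot(1)$ is the diagram consisting of the Ferrers diagram of $\delta_p$ together with the cell $(p,p)$. That $D$ contains $\delta_p\cdot(1)$ as a subdiagram in rows $1,\dots,p$ and columns $1,\dots,p$ means $D\cap(\{1,\dots,p\}\times\{1,\dots,p\})=\{(i,j): i,j\ge1,\ i+j\le p\}\cup\{(p,p)\}$. *)

theory Defs
  imports
    Complex_Main
    "HOL-Algebra.Sym_Groups"
    "HOL-Algebra.AbelCoset"
    "HOL-Algebra.Module"
begin

section \<open>Diagrams, fillings and James-Peel moves\<close>

text \<open>A cell is a pair (row, column), both coordinates counted from 1.\<close>

type_synonym cell = "nat \<times> nat"

definition diagram :: "cell set \<Rightarrow> bool" where
  "diagram D \<longleftrightarrow> finite D \<and> D \<subseteq> {1..} \<times> {1..}"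

text \<open>Only the values of a filling on \<open>D\<close> matter; outside \<open>D\<close> it is arbitrary.\<close>

definition filling :: "cell set \<Rightarrow> (cell \<Rightarrow> nat) \<Rightarrow> bool" where
  "filling D T \<longleftrightarrow> bij_betw T D {1..card D}"

definition row_move :: "nat \<Rightarrow> nat \<Rightarrow> cell set \<Rightarrow> cell set" where
  "row_move a b D = (\<lambda>(i, j). if i = a \<and> (b, j) \<notin> D then (b, j) else (i, j)) ` D"

definition col_move :: "nat \<Rightarrow> nat \<Rightarrow> cell set \<Rightarrow> cell set" where
  "col_move c d D = (\<lambda>(i, j). if j = c \<and> (i, d) \<notin> D then (i, d) else (i, j)) ` D"

text \<open>The Ferrers diagram of the staircase partition \<open>(p-1, p-2, \<dots>, 1)\<close>: row \<open>i\<close> consists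
  of the cells in columns \<open>1, \<dots>, p-i\<close>.\<close>

definition staircase :: "nat \<Rightarrow> cell set" where
  "staircase p = {(i, j). 1 \<le> i \<and> 1 \<le> j \<and> i + j \<le> p}"

definition contains_staircase_dot_one :: "nat \<Rightarrow> cell set \<Rightarrow> bool" where
  "contains_staircase_dot_one p D \<longleftrightarrow> D \<inter> ({1..p} \<times> {1..p}) = staircase p \<union> {(p, p)}"


section \<open>The complex group algebra and its left modules\<close>

text \<open>The group algebra of a finite group \<open>G\<close>: an element is a function giving the coefficients
  of the group elements, equal to 0 outside \<open>carrier G\<close>; multiplication is convolution.\<close>

definition group_algebra :: "('g, 'm) monoid_scheme \<Rightarrow> ('g \<Rightarrow> complex) ring" where
  "group_algebra G =
    \<lparr>carrier = {f. \<forall>g. g \<notin> carrier G \<longrightarrow> f g = 0},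
     mult = (\<lambda>f h g. \<Sum>a\<in>carrier G. \<Sum>b\<in>carrier G. if a \<otimes>\<^bsub>G\<^esub> b = g then f a * h b else 0),
     one = (\<lambda>g. if g = \<one>\<^bsub>G\<^esub> then 1 else 0),
     zero = (\<lambda>g. 0),
     add = (\<lambda>f h g. f g + h g)\<rparr>"

abbreviation sym_algebra :: "nat \<Rightarrow> ((nat \<Rightarrow> nat) \<Rightarrow> complex) ring" where
  "sym_algebra n \<equiv> group_algebra (sym_group n)"

text \<open>The locale \<open>module\<close> of the library requires a commutative ring of scalars, so for left
  modules over a group algebra we only use the record type \<open>module\<close> (whose fields \<open>mult\<close> and
  \<open>one\<close> play no role for modules) and the locale \<open>submodule\<close>, which does not have that
  restriction.\<close>

definition left_regular_module :: "'a ring \<Rightarrow> ('a, 'a) module" where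
  "left_regular_module A =
    \<lparr>carrier = carrier A, mult = mult A, one = one A, zero = zero A, add = add A,
     smult = mult A\<rparr>"

text \<open>The quotient \<open>M / N\<close>: its elements are the cosets of \<open>N\<close> in \<open>M\<close>, and \<open>a\<close> times the
  coset of \<open>x\<close> is the coset of \<open>a \<odot> x\<close>.\<close>

definition quotient_module :: "('a, 'b) module \<Rightarrow> 'b set \<Rightarrow> ('a, 'b set) module" where
  "quotient_module M N =
    \<lparr>carrier = a_rcosets\<^bsub>M\<^esub> N, mult = undefined, one = undefined, zero = N, add = set_add M,
     smult = (\<lambda>a X. \<Union>x\<in>X. N +>\<^bsub>M\<^esub> (a \<odot>\<^bsub>M\<^esub> x))\<rparr>"

definition module_hom ::
    "'a ring \<Rightarrow> ('a, 'b) module \<Rightarrow> ('a, 'c) module \<Rightarrow> ('b \<Rightarrow> 'c) set" where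
  "module_hom A M N =
    {f. f \<in> carrier M \<rightarrow> carrier N \<and>
        (\<forall>x\<in>carrier M. \<forall>y\<in>carrier M. f (x \<oplus>\<^bsub>M\<^esub> y) = f x \<oplus>\<^bsub>N\<^esub> f y) \<and>
        (\<forall>a\<in>carrier A. \<forall>x\<in>carrier M. f (a \<odot>\<^bsub>M\<^esub> x) = a \<odot>\<^bsub>N\<^esub> f x)}"

definition module_surjection ::
    "'a ring \<Rightarrow> ('a, 'b) module \<Rightarrow> ('a, 'c) module \<Rightarrow> ('b \<Rightarrow> 'c) \<Rightarrow> bool" where
  "module_surjection A M N f \<longleftrightarrow> f \<in> module_hom A M N \<and> f ` carrier M = carrier N"


section \<open>Specht modules of diagrams\<close>

text \<open>A permutation \<open>\<sigma>\<close> acts on a filling by \<open>\<sigma> \<circ> T\<close>. It permutes entries within rows if the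
  cell \<open>c'\<close> containing \<open>\<sigma> (T c)\<close> always lies in the row of \<open>c\<close>.\<close>

definition row_group :: "cell set \<Rightarrow> (cell \<Rightarrow> nat) \<Rightarrow> (nat \<Rightarrow> nat) set" where
  "row_group D T = {\<sigma> \<in> carrier (sym_group (card D)).
     \<forall>c\<in>D. \<forall>c'\<in>D. \<sigma> (T c) = T c' \<longrightarrow> fst c' = fst c}"

definition col_group :: "cell set \<Rightarrow> (cell \<Rightarrow> nat) \<Rightarrow> (nat \<Rightarrow> nat) set" where
  "col_group D T = {\<sigma> \<in> carrier (sym_group (card D)).
     \<forall>c\<in>D. \<forall>c'\<in>D. \<sigma> (T c) = T c' \<longrightarrow> snd c' = snd c}"

text \<open>The product \<open>qp\<close> is \<open>q \<circ> p\<close>; the value at \<open>\<sigma>\<close> is the coefficient of \<open>\<sigma>\<close>.\<close>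

definition young_symmetrizer :: "cell set \<Rightarrow> (cell \<Rightarrow> nat) \<Rightarrow> (nat \<Rightarrow> nat) \<Rightarrow> complex" where
  "young_symmetrizer D T =
    (\<lambda>\<sigma>. \<Sum>p\<in>row_group D T. \<Sum>q\<in>col_group D T.
       if q \<circ> p = \<sigma> then of_int (sign q) else 0)"

text \<open>The left ideal generated by the Young symmetrizer, as a left module. It depends on the
  filling \<open>T\<close> only up to isomorphism.\<close>

definition specht_module ::
    "cell set \<Rightarrow> (cell \<Rightarrow> nat) \<Rightarrow> ((nat \<Rightarrow> nat) \<Rightarrow> complex, (nat \<Rightarrow> nat) \<Rightarrow> complex) module" where
  "specht_module D T = (left_regular_module (sym_algebra (card D)))
     \<lparr>carrier := {x \<otimes>\<^bsub>sym_algebra (card D)\<^esub> young_symmetrizer D T | x.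
                  x \<in> carrier (sym_algebra (card D))}\<rparr>"

end

theory Submission
  imports Defs
begin

text \<open>
  Moving cells of \<open>D\<close> horizontally changes the column group but not the row group, so with
  \<open>\<rho>\<close> the row symmetrizer of \<open>D\<close>, the Specht module of \<open>C\<^bsub>p\<rightarrow>i\<^esub>D\<close> is the left ideal \<open>N\<^sub>i\<close> generated by
  \<open>\<kappa>\<^sub>i \<rho>\<close>, where \<open>\<kappa>\<^sub>i\<close> is the column antisymmetrizer of \<open>C\<^bsub>p\<rightarrow>i\<^esub>D\<close>. Take \<open>M\<^sub>j = N\<^sub>1 + \<dots> + N\<^sub>j\<close>; since
  \<open>\<kappa>\<^sub>i \<kappa> \<rho>\<close> is a nonzero multiple of \<open>\<kappa>\<^sub>i \<rho>\<close>, every \<open>N\<^sub>i\<close> lies in \<open>N\<^sub>p = S\<^sup>D\<close>. The surjection from \<open>M\<^sub>j\<close> is right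
  multiplication by the row symmetrizer \<open>\<eta>\<^sub>j\<close> of \<open>R\<^bsub>p\<rightarrow>p-j+1\<^esub>C\<^bsub>p\<rightarrow>j\<^esub>D\<close>: the product \<open>\<kappa>\<^sub>j \<rho> \<eta>\<^sub>j\<close> is a nonzero
  multiple of \<open>\<kappa>\<^sub>j \<eta>\<^sub>j\<close>, and \<open>\<kappa>\<^sub>i \<rho> \<eta>\<^sub>j = 0\<close> for \<open>i < j\<close>, because \<open>C\<^bsub>p\<rightarrow>i\<^esub>D\<close> has one cell fewer than
  \<open>C\<^bsub>p\<rightarrow>j\<^esub>D\<close> that can move from row \<open>p\<close> to row \<open>p-j+1\<close>.
\<close>

section \<open>Left ideals and quotient modules\<close>

text \<open>\<open>left_regular_module\<close> is only defined for ring records without further fields.\<close>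

locale plain_ring = ring R for R :: "'a ring" (structure)

lemma submodule_left_regular_iff:
  fixes R :: "'a ring" (structure)
  shows "submodule H R ((left_regular_module R)\<lparr>carrier := K\<rparr>) \<longleftrightarrow>
    subgroup H ((add_monoid R)\<lparr>carrier := K\<rparr>) \<and> (\<forall>a\<in>carrier R. \<forall>x\<in>H. a \<otimes> x \<in> H)"
proof -
  \<comment> \<open>The two additive monoids agree in carrier, addition and zero but are records of
    different types, so the inverses that enter \<open>subgroup\<close> have to be identified
    first.\<close>
  have "m_inv (add_monoid ((left_regular_module R)\<lparr>carrier := K\<rparr>)) =
      m_inv ((add_monoid R)\<lparr>carrier := K\<rparr>)"
    by (simp add: m_inv_def fun_eq_iff left_regular_module_def)
  then show ?thesis
    by (auto simp: submodule_def submodule_axioms_def subgroup_def left_regular_module_def)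
qed

lemma submodule_left_regular_carrier_iff:
  fixes R :: "'a ring" (structure)
  shows "submodule H R (left_regular_module R) \<longleftrightarrow>
    subgroup H (add_monoid R) \<and> (\<forall>a\<in>carrier R. \<forall>x\<in>H. a \<otimes> x \<in> H)"
  using submodule_left_regular_iff[of H R "carrier R"] by (simp add: left_regular_module_def)

lemma (in plain_ring) submodule_left_regularI:
  assumes "K \<subseteq> carrier R" "\<zero> \<in> K"
    and "\<And>x y. x \<in> K \<Longrightarrow> y \<in> K \<Longrightarrow> x \<oplus> y \<in> K"
    and "\<And>a x. a \<in> carrier R \<Longrightarrow> x \<in> K \<Longrightarrow> a \<otimes> x \<in> K"
  shows "submodule K R (left_regular_module R)"
proof -
  have "subgroup K (add_monoid R)"
  proof (rule add.subgroupI)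
    show "K \<subseteq> carrier R" "K \<noteq> {}" using assms(1,2) by auto
  next
    fix x assume x: "x \<in> K"
    then have xR: "x \<in> carrier R" using assms(1) by blast
    \<comment> \<open>Closure under negation follows from closure under multiplication, because
      \<open>\<ominus> x\<close> is a multiple of \<open>x\<close>.\<close>
    have "(\<ominus> \<one>) \<otimes> x = \<ominus> x"
      using xR by (simp add: l_minus)
    moreover have "(\<ominus> \<one>) \<otimes> x \<in> K" using x by (intro assms(4)) auto
    ultimately show "\<ominus> x \<in> K" by simp
  next
    fix x y assume "x \<in> K" "y \<in> K"
    then show "x \<oplus> y \<in> K" using assms(3) by simp
  qed
  then show ?thesis
    using assms(4) by (simp add: submodule_left_regular_carrier_iff)
qed

lemma (in plain_ring) submodule_left_regularD:
  assumes "submodule K R (left_regular_module R)"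
  shows "K \<subseteq> carrier R" "\<zero> \<in> K"
    and "\<And>x y. x \<in> K \<Longrightarrow> y \<in> K \<Longrightarrow> x \<oplus> y \<in> K"
    and "\<And>a x. a \<in> carrier R \<Longrightarrow> x \<in> K \<Longrightarrow> a \<otimes> x \<in> K"
proof -
  have K: "subgroup K (add_monoid R)" "\<forall>a\<in>carrier R. \<forall>x\<in>K. a \<otimes> x \<in> K"
    using assms by (simp_all add: submodule_left_regular_carrier_iff)
  interpret K: additive_subgroup K R using K(1) by (rule additive_subgroupI)
  show "K \<subseteq> carrier R" "\<zero> \<in> K" by (rule K.a_subset, rule K.zero_closed)
  show "x \<oplus> y \<in> K" if "x \<in> K" "y \<in> K" for x y using that by (rule K.a_closed)
  show "a \<otimes> x \<in> K" if "a \<in> carrier R" "x \<in> K" for a x using that K(2) by blast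
qed

text \<open>The construction works with left ideals of the whole algebra, while the filtration asks
  for submodules of \<open>S^D\<close>; this passes from the former to the latter.\<close>

lemma (in plain_ring) submodule_left_regular_restrict:
  assumes H: "submodule H R (left_regular_module R)"
    and K: "submodule K R (left_regular_module R)" and "H \<subseteq> K"
  shows "submodule H R ((left_regular_module R)\<lparr>carrier := K\<rparr>)"
  using assms add.subgroup_incl[of H K]
  by (simp add: submodule_left_regular_iff submodule_left_regular_carrier_iff)

text \<open>Right multiplication by \<open>c\<close> commutes with the left action. As it kills
  \<open>H\<close>, it is constant on cosets and descends to \<open>K / H\<close>, with image
  \<open>J\<close>.\<close>

lemma (in plain_ring) quotient_module_surjection:
  assumes K: "submodule K R (left_regular_module R)"
    and H: "submodule H R (left_regular_module R)"
    and c: "c \<in> carrier R"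
    and ann: "\<And>x. x \<in> H \<Longrightarrow> x \<otimes> c = \<zero>"
    and img: "(\<lambda>x. x \<otimes> c) ` K = J"
  shows "\<exists>f. module_surjection R (quotient_module ((left_regular_module R)\<lparr>carrier := K\<rparr>) H)
      ((left_regular_module R)\<lparr>carrier := J\<rparr>) f"
proof -
  note KD = submodule_left_regularD[OF K]
  note HD = submodule_left_regularD[OF H]
  let ?M = "(left_regular_module R)\<lparr>carrier := K\<rparr>"
  let ?Q = "quotient_module ?M H"
  \<comment> \<open>Only cosets matter as arguments; on a coset \<open>x \<otimes> c\<close> takes a
    single value, so the image is a singleton.\<close>
  define f where "f X = the_elem ((\<lambda>x. x \<otimes> c) ` X)" for X
  have fI: "f X = v" if "X \<noteq> {}" "\<And>x. x \<in> X \<Longrightarrow> x \<otimes> c = v" for X v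
  proof -
    have "(\<lambda>x. x \<otimes> c) ` X = {v}" using that by (auto simp: image_iff)
    then show ?thesis by (simp add: f_def)
  qed
  have coset: "H +>\<^bsub>?M\<^esub> x = {h \<oplus> x | h. h \<in> H}" for x
    by (auto simp: a_r_coset_def' left_regular_module_def)
  have carr: "carrier ?Q = {{h \<oplus> x | h. h \<in> H} | x. x \<in> K}"
    by (auto simp: quotient_module_def A_RCOSETS_def' coset)
  have val: "(h \<oplus> x) \<otimes> c = x \<otimes> c" if "h \<in> H" "x \<in> carrier R" for h x
    using that HD(1) c ann by (simp add: l_distr subset_iff)
  have f_coset: "f {h \<oplus> x | h. h \<in> H} = x \<otimes> c" if "x \<in> carrier R" for x
    by (rule fI) (use HD(2) that val in auto)
  have "f \<in> module_hom R ?Q ((left_regular_module R)\<lparr>carrier := J\<rparr>)"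
    unfolding module_hom_def
  proof (intro CollectI conjI ballI)
    show "f \<in> carrier ?Q \<rightarrow> carrier ((left_regular_module R)\<lparr>carrier := J\<rparr>)"
      using KD(1) img by (auto simp: carr f_coset subset_iff)
  next
    fix X Y assume "X \<in> carrier ?Q" "Y \<in> carrier ?Q"
    then obtain x y where x: "x \<in> K" "X = {h \<oplus> x | h. h \<in> H}"
      and y: "y \<in> K" "Y = {h \<oplus> y | h. h \<in> H}" by (auto simp: carr)
    have xy: "x \<in> carrier R" "y \<in> carrier R" using x y KD(1) by auto
    have "f (X \<oplus>\<^bsub>?Q\<^esub> Y) = x \<otimes> c \<oplus> y \<otimes> c"
    proof (rule fI)
      show "X \<oplus>\<^bsub>?Q\<^esub> Y \<noteq> {}"
        using x y HD(2) by (auto simp: quotient_module_def set_add_def' )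
      fix z assume "z \<in> X \<oplus>\<^bsub>?Q\<^esub> Y"
      then obtain h k where "h \<in> H" "k \<in> H" "z = (h \<oplus> x) \<oplus> (k \<oplus> y)"
        using x y by (auto simp: quotient_module_def set_add_def' left_regular_module_def)
      then show "z \<otimes> c = x \<otimes> c \<oplus> y \<otimes> c"
        using xy HD(1) c val by (simp add: l_distr[of "h \<oplus> x" "k \<oplus> y"] subset_iff)
    qed
    then show "f (X \<oplus>\<^bsub>?Q\<^esub> Y) = f X \<oplus>\<^bsub>(left_regular_module R)\<lparr>carrier := J\<rparr>\<^esub> f Y"
      using x y xy f_coset by (simp add: left_regular_module_def)
  next
    fix a X assume a: "a \<in> carrier R" and "X \<in> carrier ?Q"
    then obtain x where x: "x \<in> K" "X = {h \<oplus> x | h. h \<in> H}" by (auto simp: carr)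
    have xR: "x \<in> carrier R" using x KD(1) by auto
    have "f (a \<odot>\<^bsub>?Q\<^esub> X) = a \<otimes> (x \<otimes> c)"
    proof (rule fI)
      show "a \<odot>\<^bsub>?Q\<^esub> X \<noteq> {}"
        using x HD(2) by (auto simp: quotient_module_def coset)
      \<comment> \<open>The multiple of a coset is a union of cosets, so its elements carry two
        terms from \<open>H\<close>: \<open>h\<close> from the element of \<open>X\<close> and
        \<open>k\<close> from the coset of its multiple.\<close>
      fix z assume "z \<in> a \<odot>\<^bsub>?Q\<^esub> X"
      then obtain h k where hk: "h \<in> H" "k \<in> H" "z = k \<oplus> a \<otimes> (h \<oplus> x)"
        using x by (auto simp: quotient_module_def coset) (auto simp: left_regular_module_def)
      then have "h \<in> carrier R" using HD(1) by auto
      then show "z \<otimes> c = a \<otimes> (x \<otimes> c)"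
        using hk xR a c val[of k "a \<otimes> (h \<oplus> x)"] val[of h x] by (simp add: m_assoc)
    qed
    then show "f (a \<odot>\<^bsub>?Q\<^esub> X) = a \<odot>\<^bsub>(left_regular_module R)\<lparr>carrier := J\<rparr>\<^esub> f X"
      using x xR f_coset by (simp add: left_regular_module_def)
  qed
  moreover have "f ` carrier ?Q = J"
  proof -
    have "carrier ?Q = (\<lambda>x. {h \<oplus> x | h. h \<in> H}) ` K" by (auto simp: carr)
    then have "f ` carrier ?Q = (\<lambda>x. x \<otimes> c) ` K"
      using f_coset KD(1) by (auto simp: image_image subset_iff intro!: image_cong)
    with img show ?thesis by simp
  qed
  ultimately show ?thesis
    unfolding module_surjection_def by auto
qed

section \<open>Sums of left ideals and principal left ideals\<close>

fun partial_sum :: "'a ring \<Rightarrow> (nat \<Rightarrow> 'a set) \<Rightarrow> nat \<Rightarrow> 'a set" where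
  "partial_sum R N 0 = {\<zero>\<^bsub>R\<^esub>}"
| "partial_sum R N (Suc j) = partial_sum R N j <+>\<^bsub>R\<^esub> N (Suc j)"

definition left_ideal :: "'a ring \<Rightarrow> 'a \<Rightarrow> 'a set" where
  "left_ideal R y = {x \<otimes>\<^bsub>R\<^esub> y | x. x \<in> carrier R}"

context plain_ring
begin

lemma partial_sum_submodule:
  assumes "\<And>i. i \<in> {1..j} \<Longrightarrow> submodule (N i) R (left_regular_module R)"
  shows "submodule (partial_sum R N j) R (left_regular_module R)"
  using assms
proof (induction j)
  case 0
  show ?case by (rule submodule_left_regularI) auto
next
  case (Suc j)
  have "submodule (partial_sum R N j) R (left_regular_module R)"
    by (rule Suc.IH, rule Suc.prems, simp)
  note D = submodule_left_regularD[OF this]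
  have "submodule (N (Suc j)) R (left_regular_module R)"
    by (rule Suc.prems) simp
  note E = submodule_left_regularD[OF this]
  show ?case
  proof (rule submodule_left_regularI)
    show "partial_sum R N (Suc j) \<subseteq> carrier R"
      using D(1) E(1) by (auto simp: set_add_def')
    show "\<zero> \<in> partial_sum R N (Suc j)"
      using D(2) E(2) by (auto simp: set_add_def' intro!: bexI[of _ \<zero>])
  next
    fix x y assume "x \<in> partial_sum R N (Suc j)" "y \<in> partial_sum R N (Suc j)"
    then obtain a b c d where *: "a \<in> partial_sum R N j" "b \<in> N (Suc j)" "x = a \<oplus> b"
      "c \<in> partial_sum R N j" "d \<in> N (Suc j)" "y = c \<oplus> d" by (auto simp: set_add_def')
    then have "a \<in> carrier R" "b \<in> carrier R" "c \<in> carrier R" "d \<in> carrier R"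
      using D(1) E(1) by auto
    then have "x \<oplus> y = (a \<oplus> c) \<oplus> (b \<oplus> d)" using * by (simp add: a_ac)
    moreover have "a \<oplus> c \<in> partial_sum R N j" "b \<oplus> d \<in> N (Suc j)"
      using * D(3) E(3) by auto
    ultimately show "x \<oplus> y \<in> partial_sum R N (Suc j)" by (auto simp: set_add_def')
  next
    fix r x assume r: "r \<in> carrier R" "x \<in> partial_sum R N (Suc j)"
    then obtain a b where *: "a \<in> partial_sum R N j" "b \<in> N (Suc j)" "x = a \<oplus> b"
      by (auto simp: set_add_def')
    then have "a \<in> carrier R" "b \<in> carrier R"
      using D(1) E(1) by auto
    then have "r \<otimes> x = r \<otimes> a \<oplus> r \<otimes> b" using * r by (simp add: r_distr)
    moreover have "r \<otimes> a \<in> partial_sum R N j" "r \<otimes> b \<in> N (Suc j)"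
      using * r D(4) E(4) by auto
    ultimately show "r \<otimes> x \<in> partial_sum R N (Suc j)" by (auto simp: set_add_def')
  qed
qed

lemma partial_sum_subset:
  assumes "\<And>i. i \<in> {1..j} \<Longrightarrow> N i \<subseteq> K" "submodule K R (left_regular_module R)"
  shows "partial_sum R N j \<subseteq> K"
  using assms(1)
proof (induction j)
  case 0
  show ?case using submodule_left_regularD(2)[OF assms(2)] by simp
next
  case (Suc j)
  have "x \<oplus> y \<in> K" if "x \<in> partial_sum R N j" "y \<in> N (Suc j)" for x y
  proof (rule submodule_left_regularD(3)[OF assms(2)])
    have "partial_sum R N j \<subseteq> K"
      by (rule Suc.IH, rule Suc.prems, simp)
    with that(1) show "x \<in> K" ..
    have "N (Suc j) \<subseteq> K"
      by (rule Suc.prems) simp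
    with that(2) show "y \<in> K" ..
  qed
  then show ?case by (auto simp: set_add_def')
qed

lemma partial_sum_Suc_supset:
  assumes "\<And>i. i \<in> {1..Suc j} \<Longrightarrow> submodule (N i) R (left_regular_module R)"
  shows "partial_sum R N j \<subseteq> partial_sum R N (Suc j)" "N (Suc j) \<subseteq> partial_sum R N (Suc j)"
proof -
  have P: "submodule (partial_sum R N j) R (left_regular_module R)"
    using assms by (intro partial_sum_submodule) auto
  note D = submodule_left_regularD[OF P]
  have "submodule (N (Suc j)) R (left_regular_module R)"
    by (rule assms) simp
  note E = submodule_left_regularD[OF this]
  show "partial_sum R N j \<subseteq> partial_sum R N (Suc j)"
  proof
    fix x assume "x \<in> partial_sum R N j"
    moreover from this have "x = x \<oplus> \<zero>" using D(1) by auto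
    moreover have "\<zero> \<in> N (Suc j)" by (rule E(2))
    ultimately show "x \<in> partial_sum R N (Suc j)" unfolding partial_sum.simps set_add_def' by blast
  qed
  show "N (Suc j) \<subseteq> partial_sum R N (Suc j)"
  proof
    fix x assume "x \<in> N (Suc j)"
    moreover from this have "x = \<zero> \<oplus> x" using E(1) by auto
    ultimately show "x \<in> partial_sum R N (Suc j)"
      using D(2) unfolding partial_sum.simps set_add_def' by blast
  qed
qed

text \<open>The elements annihilated by \<open>c\<close> from the right form a left ideal, so
  \<open>partial_sum_subset\<close> reduces the claim to the summands.\<close>

lemma partial_sum_annihilated:
  assumes "\<And>i x. i \<in> {1..j} \<Longrightarrow> x \<in> N i \<Longrightarrow> x \<otimes> c = \<zero>"
    and "\<And>i. i \<in> {1..j} \<Longrightarrow> submodule (N i) R (left_regular_module R)" "c \<in> carrier R"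
    and "x \<in> partial_sum R N j"
  shows "x \<otimes> c = \<zero>"
proof -
  let ?K = "{x \<in> carrier R. x \<otimes> c = \<zero>}"
  have "submodule ?K R (left_regular_module R)"
    by (rule submodule_left_regularI) (use assms(3) in \<open>auto simp: l_distr m_assoc\<close>)
  moreover have "N i \<subseteq> ?K" if "i \<in> {1..j}" for i
    using assms(1)[OF that] submodule_left_regularD(1)[OF assms(2)[OF that]] by auto
  ultimately have "partial_sum R N j \<subseteq> ?K" by (intro partial_sum_subset) auto
  with assms(4) show ?thesis by auto
qed

lemma left_ideal_submodule:
  assumes "y \<in> carrier R"
  shows "submodule (left_ideal R y) R (left_regular_module R)"
proof (rule submodule_left_regularI)
  show "left_ideal R y \<subseteq> carrier R" using assms by (auto simp: left_ideal_def)
  have "\<zero> = \<zero> \<otimes> y" using assms by simp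
  then show "\<zero> \<in> left_ideal R y" unfolding left_ideal_def by blast
next
  fix u v assume "u \<in> left_ideal R y" "v \<in> left_ideal R y"
  then obtain a b where "a \<in> carrier R" "b \<in> carrier R" "u = a \<otimes> y" "v = b \<otimes> y"
    by (auto simp: left_ideal_def)
  then have "u \<oplus> v = (a \<oplus> b) \<otimes> y" "a \<oplus> b \<in> carrier R" using assms by (auto simp: l_distr)
  then show "u \<oplus> v \<in> left_ideal R y" unfolding left_ideal_def by blast
next
  fix r u assume "r \<in> carrier R" "u \<in> left_ideal R y"
  then obtain a where "a \<in> carrier R" "u = a \<otimes> y" by (auto simp: left_ideal_def)
  then have "r \<otimes> u = (r \<otimes> a) \<otimes> y" "r \<otimes> a \<in> carrier R"
    using assms \<open>r \<in> carrier R\<close> by (auto simp: m_assoc)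
  then show "r \<otimes> u \<in> left_ideal R y" unfolding left_ideal_def by blast
qed

lemma left_ideal_mult_subset:
  assumes "a \<in> carrier R" "y \<in> carrier R"
  shows "left_ideal R (a \<otimes> y) \<subseteq> left_ideal R y"
proof
  fix z assume "z \<in> left_ideal R (a \<otimes> y)"
  then obtain x where "x \<in> carrier R" "z = x \<otimes> (a \<otimes> y)" by (auto simp: left_ideal_def)
  then have "x \<otimes> a \<in> carrier R" "z = (x \<otimes> a) \<otimes> y" using assms by (auto simp: m_assoc)
  then show "z \<in> left_ideal R y" unfolding left_ideal_def by blast
qed

lemma image_left_ideal:
  assumes "y \<in> carrier R" "c \<in> carrier R"
  shows "(\<lambda>v. v \<otimes> c) ` left_ideal R y = left_ideal R (y \<otimes> c)"
proof -
  have "(\<lambda>v. v \<otimes> c) ` left_ideal R y = (\<lambda>x. x \<otimes> y \<otimes> c) ` carrier R"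
    by (auto simp: left_ideal_def)
  also have "\<dots> = (\<lambda>x. x \<otimes> (y \<otimes> c)) ` carrier R"
    using assms by (intro image_cong) (auto simp: m_assoc)
  finally show ?thesis by (auto simp: left_ideal_def)
qed

end

section \<open>Group algebras\<close>

text \<open>Bookkeeping for associativity of convolution: the sum over the intermediate product
  \<open>d\<close> has to become the innermost one, where it collapses.\<close>

lemma sum_rotate:
  "(\<Sum>d\<in>D. \<Sum>c\<in>C. \<Sum>a\<in>A. \<Sum>b\<in>B. F a b c d) = (\<Sum>a\<in>A. \<Sum>b\<in>B. \<Sum>c\<in>C. \<Sum>d\<in>D. F a b c d)"
proof -
  have "(\<Sum>d\<in>D. \<Sum>c\<in>C. \<Sum>a\<in>A. \<Sum>b\<in>B. F a b c d) = (\<Sum>c\<in>C. \<Sum>d\<in>D. \<Sum>a\<in>A. \<Sum>b\<in>B. F a b c d)"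
    by (rule sum.swap)
  also have "\<dots> = (\<Sum>c\<in>C. \<Sum>a\<in>A. \<Sum>d\<in>D. \<Sum>b\<in>B. F a b c d)"
    by (rule sum.cong[OF refl], rule sum.swap)
  also have "\<dots> = (\<Sum>a\<in>A. \<Sum>c\<in>C. \<Sum>d\<in>D. \<Sum>b\<in>B. F a b c d)"
    by (rule sum.swap)
  also have "\<dots> = (\<Sum>a\<in>A. \<Sum>c\<in>C. \<Sum>b\<in>B. \<Sum>d\<in>D. F a b c d)"
    by (rule sum.cong[OF refl], rule sum.cong[OF refl], rule sum.swap)
  also have "\<dots> = (\<Sum>a\<in>A. \<Sum>b\<in>B. \<Sum>c\<in>C. \<Sum>d\<in>D. F a b c d)"
    by (rule sum.cong[OF refl], rule sum.swap)
  finally show ?thesis .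
qed

lemma group_algebra_ring:
  fixes G (structure)
  assumes "group G" "finite (carrier G)"
  shows "ring (group_algebra G)"
proof -
  interpret group G by fact
  let ?A = "group_algebra G"
  let ?C = "carrier G"
  have mult: "(f \<otimes>\<^bsub>?A\<^esub> h) g = (\<Sum>a\<in>?C. \<Sum>b\<in>?C. if a \<otimes> b = g then f a * h b else 0)" for f h g
    by (simp add: group_algebra_def)
  have closed: "f \<otimes>\<^bsub>?A\<^esub> h \<in> carrier ?A" for f h
    by (auto simp: group_algebra_def intro!: sum.neutral)
  show ?thesis
  proof (rule ringI)
    show "abelian_group ?A"
    proof (rule abelian_groupI)
      fix x assume "x \<in> carrier ?A"
      then show "\<exists>y\<in>carrier ?A. y \<oplus>\<^bsub>?A\<^esub> x = \<zero>\<^bsub>?A\<^esub>"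
        by (intro bexI[of _ "\<lambda>g. - x g"]) (auto simp: group_algebra_def)
    qed (auto simp: group_algebra_def algebra_simps)
    show "monoid ?A"
    proof (rule monoidI)
      show "\<one>\<^bsub>?A\<^esub> \<in> carrier ?A" by (auto simp: group_algebra_def)
    next
      fix f h k assume "f \<in> carrier ?A" "h \<in> carrier ?A" "k \<in> carrier ?A"
      \<comment> \<open>Both bracketings are reduced to this sum over triples with product
        \<open>g\<close>. The intermediate product appears as a summation variable \<open>d\<close>,
        of which a given triple admits only one value.\<close>
      let ?S = "\<lambda>g. \<Sum>a\<in>?C. \<Sum>b\<in>?C. \<Sum>c\<in>?C. if a \<otimes> b \<otimes> c = g then f a * h b * k c else 0"
      have "((f \<otimes>\<^bsub>?A\<^esub> h) \<otimes>\<^bsub>?A\<^esub> k) g = ?S g" for g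
      proof -
        have "((f \<otimes>\<^bsub>?A\<^esub> h) \<otimes>\<^bsub>?A\<^esub> k) g
          = (\<Sum>d\<in>?C. \<Sum>c\<in>?C. \<Sum>a\<in>?C. \<Sum>b\<in>?C.
              if a \<otimes> b = d then (if d \<otimes> c = g then f a * h b * k c else 0) else 0)"
          unfolding mult[of _ k] mult
          by (intro sum.cong refl) (auto simp: sum_distrib_right intro!: sum.cong sum.neutral)
        also have "\<dots> = (\<Sum>a\<in>?C. \<Sum>b\<in>?C. \<Sum>c\<in>?C. \<Sum>d\<in>?C.
              if a \<otimes> b = d then (if d \<otimes> c = g then f a * h b * k c else 0) else 0)"
          by (rule sum_rotate)
        also have "\<dots> = ?S g"
          using assms(2) by (intro sum.cong refl) (simp add: sum.delta')
        finally show ?thesis .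
      qed
      moreover have "(f \<otimes>\<^bsub>?A\<^esub> (h \<otimes>\<^bsub>?A\<^esub> k)) g = ?S g" for g
      proof -
        have "(f \<otimes>\<^bsub>?A\<^esub> (h \<otimes>\<^bsub>?A\<^esub> k)) g
          = (\<Sum>a\<in>?C. \<Sum>d\<in>?C. \<Sum>b\<in>?C. \<Sum>c\<in>?C.
              if b \<otimes> c = d then (if a \<otimes> d = g then f a * h b * k c else 0) else 0)"
          unfolding mult[of f] mult
          by (intro sum.cong refl) (auto simp: sum_distrib_left mult.assoc intro!: sum.cong sum.neutral)
        also have "\<dots> = (\<Sum>a\<in>?C. \<Sum>b\<in>?C. \<Sum>c\<in>?C. \<Sum>d\<in>?C.
              if b \<otimes> c = d then (if a \<otimes> d = g then f a * h b * k c else 0) else 0)"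
          by (rule sum.cong[OF refl], rule trans[OF sum.swap], rule sum.cong[OF refl], rule sum.swap)
        also have "\<dots> = ?S g"
          using assms(2) by (intro sum.cong refl) (simp add: sum.delta' m_assoc)
        finally show ?thesis .
      qed
      ultimately show "(f \<otimes>\<^bsub>?A\<^esub> h) \<otimes>\<^bsub>?A\<^esub> k = f \<otimes>\<^bsub>?A\<^esub> (h \<otimes>\<^bsub>?A\<^esub> k)" by auto
    next
      fix f assume f: "f \<in> carrier ?A"
      have "(\<one>\<^bsub>?A\<^esub> \<otimes>\<^bsub>?A\<^esub> f) g = (\<Sum>a\<in>?C. if a = \<one> then (\<Sum>b\<in>?C. if b = g then f b else 0) else 0)" for g
        unfolding mult by (intro sum.cong refl) (auto simp: group_algebra_def intro!: sum.cong sum.neutral)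
      then show "\<one>\<^bsub>?A\<^esub> \<otimes>\<^bsub>?A\<^esub> f = f"
        using assms(2) f by (auto simp: sum.delta group_algebra_def)
      have "(f \<otimes>\<^bsub>?A\<^esub> \<one>\<^bsub>?A\<^esub>) g = (\<Sum>a\<in>?C. \<Sum>b\<in>?C. if b = \<one> then (if a = g then f a else 0) else 0)" for g
        unfolding mult by (intro sum.cong refl) (auto simp: group_algebra_def)
      then show "f \<otimes>\<^bsub>?A\<^esub> \<one>\<^bsub>?A\<^esub> = f"
        using assms(2) f by (auto simp: sum.delta group_algebra_def)
    qed (rule closed)
  next
    fix x y z
    show "(x \<oplus>\<^bsub>?A\<^esub> y) \<otimes>\<^bsub>?A\<^esub> z = x \<otimes>\<^bsub>?A\<^esub> z \<oplus>\<^bsub>?A\<^esub> y \<otimes>\<^bsub>?A\<^esub> z"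
      "z \<otimes>\<^bsub>?A\<^esub> (x \<oplus>\<^bsub>?A\<^esub> y) = z \<otimes>\<^bsub>?A\<^esub> x \<oplus>\<^bsub>?A\<^esub> z \<otimes>\<^bsub>?A\<^esub> y"
      by (auto simp: group_algebra_def fun_eq_iff sum.distrib[symmetric] algebra_simps
          intro!: sum.cong)
  qed
qed

section \<open>Labelled entries and moves\<close>

text \<open>A diagram with a filling is encoded by the functions sending an entry to its row and to its
  column, so that row and column groups become stabilizers of labellings of \<open>{1..n}\<close>.\<close>

definition label_stabilizer :: "nat \<Rightarrow> (nat \<Rightarrow> 'l) \<Rightarrow> (nat \<Rightarrow> nat) set" where
  "label_stabilizer n f = {\<sigma>. \<sigma> permutes {1..n} \<and> (\<forall>x\<in>{1..n}. f (\<sigma> x) = f x)}"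

lemma label_stabilizer_comp:
  "\<sigma> \<in> label_stabilizer n f \<Longrightarrow> \<tau> \<in> label_stabilizer n f \<Longrightarrow> \<sigma> \<circ> \<tau> \<in> label_stabilizer n f"
  unfolding label_stabilizer_def
  by (auto simp: permutes_compose) (metis atLeastAtMost_iff permutes_in_image)

lemma label_stabilizer_inv:
  assumes "\<sigma> \<in> label_stabilizer n f"
  shows "inv' \<sigma> \<in> label_stabilizer n f"
proof -
  have \<sigma>: "\<sigma> permutes {1..n}" "\<And>x. x \<in> {1..n} \<Longrightarrow> f (\<sigma> x) = f x"
    using assms by (auto simp: label_stabilizer_def)
  have "f (inv' \<sigma> x) = f x" if "x \<in> {1..n}" for x
    using \<sigma>(2)[of "inv' \<sigma> x"] that \<sigma>(1)
    by (metis permutes_inv permutes_in_image permutes_inverses(1))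
  then show ?thesis using \<sigma>(1) by (auto simp: label_stabilizer_def permutes_inv)
qed

text \<open>\<open>g\<close> is the coordinate that changes and \<open>f\<close> the one that is
  kept; the quantified condition says that the target cell is empty. Leaving open which coordinate
  is the row lets one definition serve row and column moves.\<close>

definition move_label :: "'x set \<Rightarrow> ('x \<Rightarrow> 'm) \<Rightarrow> ('x \<Rightarrow> 'l) \<Rightarrow> 'l \<Rightarrow> 'l \<Rightarrow> 'x \<Rightarrow> 'l" where
  "move_label N f g a b x = (if g x = a \<and> (\<forall>v\<in>N. g v = b \<longrightarrow> f v \<noteq> f x) then b else g x)"

text \<open>An entry with label \<open>b\<close> keeps it under the move. If \<open>v\<close> met
  \<open>\<sigma> u\<close> in \<open>h\<close>, then \<open>u\<close> and the entry that
  \<open>\<sigma>\<close> sends to \<open>v\<close> would both have moved label \<open>b\<close> and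
  the same value of \<open>h\<close> after \<open>\<sigma>\<close>, against injectivity. The
  function \<open>h\<close> may differ from \<open>f\<close> because
  \<open>staircase_conflict\<close> compares two column moves.\<close>

lemma move_label_free:
  assumes \<sigma>: "\<sigma> \<in> label_stabilizer n g"
    and inj: "inj_on (\<lambda>u. (h (\<sigma> u), move_label {1..n} f g a b u)) {1..n}"
    and "a \<noteq> b" and u: "u \<in> {1..n}" "g u = a" "move_label {1..n} f g a b u = b"
    and v: "v \<in> {1..n}" "g v = b"
  shows "h v \<noteq> h (\<sigma> u)"
proof
  assume h: "h v = h (\<sigma> u)"
  let ?w = "inv' \<sigma> v"
  have p: "\<sigma> permutes {1..n}" using \<sigma> by (simp add: label_stabilizer_def)
  have w: "?w \<in> {1..n}" "\<sigma> ?w = v"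
    using v p by (metis permutes_inv permutes_in_image, metis permutes_inverses(1))
  then have "g ?w = b" using \<sigma> v by (force simp: label_stabilizer_def)
  then have "move_label {1..n} f g a b ?w = b" by (simp add: move_label_def)
  then have "?w = u" using inj_onD[OF inj _ w(1) u(1)] w(2) h u(3) by simp
  with \<open>g ?w = b\<close> u(2) \<open>a \<noteq> b\<close> show False by simp
qed

text \<open>By \<open>move_label_free\<close> with \<open>h = f\<close>, \<open>\<sigma>\<close>
  maps the set of entries that move into itself, hence onto itself by finiteness. Since
  \<open>\<sigma>\<close> also preserves \<open>g\<close>, it preserves the labels after the
  move.\<close>

lemma stabilizer_move_label:
  assumes \<sigma>: "\<sigma> \<in> label_stabilizer n g"
    and inj: "inj_on (\<lambda>u. (f (\<sigma> u), move_label {1..n} f g a b u)) {1..n}"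
  shows "\<sigma> \<in> label_stabilizer n (move_label {1..n} f g a b)"
proof (cases "a = b")
  \<comment> \<open>The trivial move does occur in the filtration: the row move for
    \<open>j = 1\<close> and the column move for \<open>j = p\<close> go from \<open>p\<close> to
    itself.\<close>
  case True
  then have "move_label {1..n} f g a b = g" by (auto simp: move_label_def)
  with \<sigma> show ?thesis by simp
next
  case False
  let ?g = "move_label {1..n} f g a b"
  let ?W = "{x\<in>{1..n}. g x = a \<and> (\<forall>v\<in>{1..n}. g v = b \<longrightarrow> f v \<noteq> f x)}"
  have p: "\<sigma> permutes {1..n}" and g: "\<And>x. x \<in> {1..n} \<Longrightarrow> g (\<sigma> x) = g x"
    using \<sigma> by (auto simp: label_stabilizer_def)
  have "\<sigma> ` ?W \<subseteq> ?W"
  proof (rule image_subsetI)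
    fix x assume "x \<in> ?W"
    then have x: "x \<in> {1..n}" "g x = a" "\<forall>v\<in>{1..n}. g v = b \<longrightarrow> f v \<noteq> f x" by auto
    then have "?g x = b" by (auto simp: move_label_def)
    then have "\<forall>v\<in>{1..n}. g v = b \<longrightarrow> f v \<noteq> f (\<sigma> x)"
      using move_label_free[OF \<sigma> inj False x(1,2)] by blast
    moreover have "\<sigma> x \<in> {1..n}" using p x(1) permutes_in_image by metis
    ultimately show "\<sigma> x \<in> ?W"
      using g x by auto
  qed
  moreover have "card (\<sigma> ` ?W) = card ?W"
    by (rule card_image) (use p in \<open>meson inj_on_subset permutes_inj subset_UNIV\<close>)
  ultimately have W: "\<sigma> ` ?W = ?W"
    by (intro card_subset_eq) auto
  have "?g (\<sigma> x) = ?g x" if x: "x \<in> {1..n}" for x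
  proof -
    have "\<sigma> x \<in> ?W \<longleftrightarrow> x \<in> ?W"
      using W permutes_inj[OF p] by (metis (no_types, lifting) inj_image_mem_iff)
    moreover have "?g y = (if y \<in> ?W then b else g y)" if "y \<in> {1..n}" for y
      using that by (auto simp: move_label_def)
    moreover have "\<sigma> x \<in> {1..n}" using p x permutes_in_image by metis
    ultimately show ?thesis using x g by presburger
  qed
  then show ?thesis using p by (auto simp: label_stabilizer_def)
qed

text \<open>Reduces to the previous lemma by passing to the inverse permutation.\<close>

lemma stabilizer_move_label':
  assumes \<sigma>: "\<sigma> \<in> label_stabilizer n g"
    and inj: "inj_on (\<lambda>u. (move_label {1..n} f g a b (\<sigma> u), f u)) {1..n}"
  shows "\<sigma> \<in> label_stabilizer n (move_label {1..n} f g a b)"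
proof -
  have p: "\<sigma> permutes {1..n}" using \<sigma> by (simp add: label_stabilizer_def)
  have i: "inv' \<sigma> \<in> {1..n} \<rightarrow> {1..n}" "inj_on (inv' \<sigma>) {1..n}"
    using permutes_in_image[OF permutes_inv[OF p]] permutes_inj_on[OF permutes_inv[OF p]] by auto
  have "inj_on (\<lambda>u. (f (inv' \<sigma> u), move_label {1..n} f g a b u)) {1..n}"
  proof (rule inj_onI)
    fix u v assume *: "u \<in> {1..n}" "v \<in> {1..n}"
      "(f (inv' \<sigma> u), move_label {1..n} f g a b u) = (f (inv' \<sigma> v), move_label {1..n} f g a b v)"
    then have "inv' \<sigma> u = inv' \<sigma> v"
      using i(1) by (intro inj_onD[OF inj]) (auto simp: permutes_inverses(1)[OF p])
    then show "u = v" using * inj_onD[OF i(2)] by blast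
  qed
  then have "inv' \<sigma> \<in> label_stabilizer n (move_label {1..n} f g a b)"
    by (intro stabilizer_move_label label_stabilizer_inv \<sigma>)
  then have "inv' (inv' \<sigma>) \<in> label_stabilizer n (move_label {1..n} f g a b)"
    by (rule label_stabilizer_inv)
  then show ?thesis using p by (simp add: permutes_inv_inv)
qed

text \<open>A moved entry lands in a cell that was empty, and two entries that both move come from
  the same line, so they differ in \<open>f\<close>.\<close>

lemma inj_on_move_label:
  assumes "inj_on (\<lambda>x. (f x, g x)) N"
  shows "inj_on (\<lambda>x. (f x, move_label N f g a b x)) N"
proof (rule inj_onI)
  fix x y assume *: "x \<in> N" "y \<in> N" "(f x, move_label N f g a b x) = (f y, move_label N f g a b y)"
  then have eq: "f x = f y" "move_label N f g a b x = move_label N f g a b y" by simp_all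
  have "g x = g y"
  proof (cases "g x = a \<and> (\<forall>v\<in>N. g v = b \<longrightarrow> f v \<noteq> f x)")
    case True
    then have "move_label N f g a b y = b" using eq by (simp add: move_label_def)
    then show ?thesis using True *(2) eq(1) by (auto simp: move_label_def split: if_splits)
  next
    case False
    then have *: "move_label N f g a b y = g x" using eq(2) by (simp only: move_label_def if_False)
    show ?thesis
    proof (cases "g y = a \<and> (\<forall>v\<in>N. g v = b \<longrightarrow> f v \<noteq> f y)")
      case True
      then have "g x = b" using * unfolding move_label_def by presburger
      then show ?thesis using True eq(1) \<open>x \<in> N\<close> by auto
    next
      case False
      then show ?thesis using * unfolding move_label_def by presburger
    qed
  qed
  with eq show "x = y" using * by (intro inj_onD[OF assms]) auto
qed

section \<open>James-Peel moves on labels and the staircase\<close>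

lemma col_move_labels:
  assumes "D = (\<lambda>x. (\<rho> x, \<kappa> x)) ` N"
  shows "col_move c d D = (\<lambda>x. (\<rho> x, move_label N \<rho> \<kappa> c d x)) ` N" (is "_ = ?rhs")
proof -
  have "(i, d) \<notin> D \<longleftrightarrow> (\<forall>v\<in>N. \<kappa> v = d \<longrightarrow> \<rho> v \<noteq> i)" for i
    using assms by auto
  then have "col_move c d D =
      (\<lambda>(i, j). if j = c \<and> (\<forall>v\<in>N. \<kappa> v = d \<longrightarrow> \<rho> v \<noteq> i) then (i, d) else (i, j)) ` D"
    by (simp add: col_move_def)
  also have "\<dots> = ?rhs"
    unfolding assms image_image by (intro image_cong refl) (auto simp: move_label_def)
  finally show ?thesis .
qed

lemma row_move_labels:
  assumes "D = (\<lambda>x. (\<rho> x, \<kappa> x)) ` N"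
  shows "row_move a b D = (\<lambda>x. (move_label N \<kappa> \<rho> a b x, \<kappa> x)) ` N" (is "_ = ?rhs")
proof -
  have "(b, j) \<notin> D \<longleftrightarrow> (\<forall>v\<in>N. \<rho> v = b \<longrightarrow> \<kappa> v \<noteq> j)" for j
    using assms by auto
  then have "row_move a b D =
      (\<lambda>(i, j). if i = a \<and> (\<forall>v\<in>N. \<rho> v = b \<longrightarrow> \<kappa> v \<noteq> j) then (b, j) else (i, j)) ` D"
    by (simp add: row_move_def)
  also have "\<dots> = ?rhs"
    unfolding assms image_image by (intro image_cong refl) (auto simp: move_label_def)
  finally show ?thesis .
qed

text \<open>The cell \<open>(p, p)\<close> makes the set \<open>W j\<close> of entries of row \<open>p\<close> that are free to move to row \<open>b\<close>
  strictly larger than \<open>W i\<close>, and a transversal permutation would embed \<open>W j\<close> into \<open>W i\<close>.\<close>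

lemma staircase_conflict:
  fixes p i j n :: nat and \<rho> \<kappa> :: "nat \<Rightarrow> nat"
  defines "b \<equiv> p - j + 1"
  defines "\<kappa>\<^sub>i \<equiv> move_label {1..n} \<rho> \<kappa> p i" and "\<kappa>\<^sub>j \<equiv> move_label {1..n} \<rho> \<kappa> p j"
  assumes D: "contains_staircase_dot_one p ((\<lambda>x. (\<rho> x, \<kappa> x)) ` {1..n})"
    and ij: "1 \<le> i" "i < j" "j \<le> p"
    and \<sigma>: "\<sigma> \<in> label_stabilizer n \<rho>"
  shows "\<not> inj_on (\<lambda>u. (\<kappa>\<^sub>i (\<sigma> u), move_label {1..n} \<kappa>\<^sub>j \<rho> p b u)) {1..n}"
proof
  assume inj: "inj_on (\<lambda>u. (\<kappa>\<^sub>i (\<sigma> u), move_label {1..n} \<kappa>\<^sub>j \<rho> p b u)) {1..n}"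
  let ?N = "{1..n}" and ?D = "(\<lambda>x. (\<rho> x, \<kappa> x)) ` {1..n}"
  \<comment> \<open>Since \<open>b + j = p + 1\<close>, the cell \<open>(b, j)\<close> lies just
    outside the staircase, while \<open>(b, i)\<close> lies inside because
    \<open>i < j\<close>.\<close>
  have b: "1 \<le> b" "b < p" "b + i \<le> p" "b + j = p + 1" using ij by (auto simp: b_def)
  have mem: "(\<exists>v\<in>?N. \<rho> v = r \<and> \<kappa> v = c) \<longleftrightarrow> r + c \<le> p \<or> (r = p \<and> c = p)"
    if "1 \<le> r" "r \<le> p" "1 \<le> c" "c \<le> p" for r c
  proof -
    have "(\<exists>v\<in>?N. \<rho> v = r \<and> \<kappa> v = c) \<longleftrightarrow> (r, c) \<in> ?D \<inter> ({1..p} \<times> {1..p})"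
      using that by auto
    also have "\<dots> \<longleftrightarrow> (r, c) \<in> staircase p \<union> {(p, p)}"
      using D by (simp only: contains_staircase_dot_one_def)
    also have "\<dots> \<longleftrightarrow> r + c \<le> p \<or> (r = p \<and> c = p)"
      using that by (auto simp: staircase_def)
    finally show ?thesis .
  qed
  \<comment> \<open>\<open>W k\<close> collects the entries of row \<open>p\<close> that are free to
    move to row \<open>b\<close> once the column move from \<open>p\<close> to \<open>k\<close> has
    been made.\<close>
  define W where "W k = {x\<in>?N. \<rho> x = p \<and> (\<forall>v\<in>?N. \<rho> v = b \<longrightarrow>
      move_label ?N \<rho> \<kappa> p k v \<noteq> move_label ?N \<rho> \<kappa> p k x)}" for k
  have col_b: "\<kappa> v \<noteq> p" "\<kappa> v \<noteq> j" if "v \<in> ?N" "\<rho> v = b" for v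
  proof -
    show "\<kappa> v \<noteq> p" "\<kappa> v \<noteq> j" using that mem[of b p] mem[of b j] b ij by auto
  qed
  have stay: "move_label ?N \<rho> \<kappa> p k x = \<kappa> x" if "\<kappa> x \<noteq> p" for k x
    using that by (simp add: move_label_def)
  \<comment> \<open>The corner \<open>(p, p)\<close> is the only cell of row \<open>p\<close> in the
    square, so nothing stops its entry from reaching column \<open>k\<close>.\<close>
  have corner: "move_label ?N \<rho> \<kappa> p k x = k" if "\<rho> x = p" "\<kappa> x = p" "1 \<le> k" "k \<le> p" for k x
  proof (cases "k = p")
    case False
    then have "\<not> (\<exists>v\<in>?N. \<rho> v = p \<and> \<kappa> v = k)" using mem[of p k] that by auto
    then show ?thesis using that by (auto simp: move_label_def)
  qed (use that in \<open>simp add: move_label_def\<close>)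
  \<comment> \<open>After the move to column \<open>i\<close>, the corner entry shares its column
    with the staircase cell \<open>(b, i)\<close> and is blocked.\<close>
  have not_i: "\<kappa> x \<noteq> p" if "x \<in> W i" for x
  proof
    assume "\<kappa> x = p"
    then have "move_label ?N \<rho> \<kappa> p i x = i" using corner that ij by (auto simp: W_def)
    moreover obtain v where "v \<in> ?N" "\<rho> v = b" "\<kappa> v = i" using mem[of b i] b ij by auto
    moreover from this have "move_label ?N \<rho> \<kappa> p i v = i" using stay ij by auto
    ultimately show False using that by (auto simp: W_def)
  qed
  \<comment> \<open>Neither the entries of row \<open>b\<close> nor those of \<open>W i\<close> lie
    in column \<open>p\<close>, so both column moves leave them in place.\<close>
  have "W i \<subseteq> W j"
  proof
    fix x assume x: "x \<in> W i"
    then have "move_label ?N \<rho> \<kappa> p j x = move_label ?N \<rho> \<kappa> p i x"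
      using not_i stay by metis
    moreover have "move_label ?N \<rho> \<kappa> p j v = move_label ?N \<rho> \<kappa> p i v" if "v \<in> ?N" "\<rho> v = b" for v
      using col_b(1)[OF that] stay by metis
    ultimately show "x \<in> W j" using x unfolding W_def by auto
  qed
  moreover obtain x where x: "x \<in> ?N" "\<rho> x = p" "\<kappa> x = p" using mem[of p p] ij by auto
  \<comment> \<open>The corner entry arrives in column \<open>j\<close>, where row \<open>b\<close>
    has no cell.\<close>
  have "x \<in> W j"
    unfolding W_def using x corner[of x j] stay col_b ij by auto
  moreover have "x \<notin> W i" using x not_i by blast
  ultimately have "W i \<subset> W j" by blast
  then have "card (W i) < card (W j)"
    by (intro psubset_card_mono) (auto simp: W_def)
  \<comment> \<open>Here \<open>move_label_free\<close> is applied with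
    \<open>h = \<kappa>\<^sub>i\<close>: entries free after the move to column \<open>j\<close> go
    to entries free after the move to column \<open>i\<close>.\<close>
  moreover have "\<sigma> ` W j \<subseteq> W i"
  proof (rule image_subsetI)
    fix x assume "x \<in> W j"
    then have x: "x \<in> ?N" "\<rho> x = p" "\<forall>v\<in>?N. \<rho> v = b \<longrightarrow> \<kappa>\<^sub>j v \<noteq> \<kappa>\<^sub>j x"
      by (auto simp: W_def \<kappa>\<^sub>j_def)
    then have "move_label ?N \<kappa>\<^sub>j \<rho> p b x = b" by (auto simp: move_label_def)
    then have "\<kappa>\<^sub>i v \<noteq> \<kappa>\<^sub>i (\<sigma> x)" if "v \<in> ?N" "\<rho> v = b" for v
      using move_label_free[OF \<sigma> inj _ x(1,2)] that b by auto
    moreover have "\<sigma> x \<in> ?N" "\<rho> (\<sigma> x) = p"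
      using \<sigma> x(1,2) permutes_in_image[of \<sigma> ?N x] by (auto simp: label_stabilizer_def)
    ultimately show "\<sigma> x \<in> W i" by (auto simp: W_def \<kappa>\<^sub>i_def)
  qed
  moreover have "card (\<sigma> ` W j) = card (W j)"
    using \<sigma> by (intro card_image permutes_inj_on) (auto simp: label_stabilizer_def)
  moreover have "finite (W i)" by (auto simp: W_def)
  ultimately show False by (metis card_mono not_less)
qed

section \<open>Symmetrizers and antisymmetrizers\<close>

definition delta :: "'g \<Rightarrow> 'g \<Rightarrow> complex" where
  "delta \<sigma> g = (if g = \<sigma> then 1 else 0)"

definition symmetrizer :: "nat \<Rightarrow> (nat \<Rightarrow> 'l) \<Rightarrow> (nat \<Rightarrow> nat) \<Rightarrow> complex" where
  "symmetrizer n f \<sigma> = (if \<sigma> \<in> label_stabilizer n f then 1 else 0)"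

definition antisymmetrizer :: "nat \<Rightarrow> (nat \<Rightarrow> 'l) \<Rightarrow> (nat \<Rightarrow> nat) \<Rightarrow> complex" where
  "antisymmetrizer n f \<sigma> = (if \<sigma> \<in> label_stabilizer n f then of_int (sign \<sigma>) else 0)"

locale symmetric_group_algebra =
  fixes n :: nat
begin

abbreviation A where "A \<equiv> sym_algebra n"
abbreviation conv (infixl "\<star>" 70) where "x \<star> y \<equiv> x \<otimes>\<^bsub>A\<^esub> y"
abbreviation perms where "perms \<equiv> {\<sigma>. \<sigma> permutes {1..n}}"

lemma finite_perms: "finite perms"
  by (rule finite_permutations) simp

sublocale plain_ring A
  unfolding plain_ring_def
  by (rule group_algebra_ring) (use sym_group_is_group finite_perms in \<open>auto simp: sym_group_def\<close>)

lemma conv_eq: "(x \<star> y) g = (\<Sum>a\<in>perms. \<Sum>b\<in>perms. if a \<circ> b = g then x a * y b else 0)"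
  by (simp add: group_algebra_def sym_group_def)

lemma carrier_iff: "x \<in> carrier A \<longleftrightarrow> (\<forall>g. \<not> g permutes {1..n} \<longrightarrow> x g = 0)"
  by (auto simp: group_algebra_def sym_group_def)

lemma one_eq: "\<one>\<^bsub>A\<^esub> = delta id"
  by (auto simp: group_algebra_def sym_group_def delta_def)

lemma zero_eq: "\<zero>\<^bsub>A\<^esub> = (\<lambda>g. 0)"
  by (auto simp: group_algebra_def)

lemma delta_carrier [simp]: "\<sigma> permutes {1..n} \<Longrightarrow> delta \<sigma> \<in> carrier A"
  by (auto simp: carrier_iff delta_def)

lemma symmetrizer_carrier [simp]: "symmetrizer n f \<in> carrier A"
  by (auto simp: carrier_iff symmetrizer_def label_stabilizer_def)

lemma antisymmetrizer_carrier [simp]: "antisymmetrizer n f \<in> carrier A"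
  by (auto simp: carrier_iff antisymmetrizer_def label_stabilizer_def)

lemma scale_carrier [simp]: "x \<in> carrier A \<Longrightarrow> (\<lambda>g. c * x g) \<in> carrier A"
  by (auto simp: carrier_iff)

lemma scale_conv: "(\<lambda>g. c * x g) \<star> y = (\<lambda>g. c * (x \<star> y) g)"
  by (auto simp: fun_eq_iff conv_eq sum_distrib_left mult.assoc intro!: sum.cong)

section \<open>Convolution with single permutations\<close>

lemma conv_delta:
  assumes x: "x \<in> carrier A" and \<sigma>: "\<sigma> permutes {1..n}"
  shows "(x \<star> delta \<sigma>) g = x (g \<circ> inv' \<sigma>)"
proof -
  have "(x \<star> delta \<sigma>) g = (\<Sum>a\<in>perms. \<Sum>b\<in>perms. if b = \<sigma> then (if a \<circ> \<sigma> = g then x a else 0) else 0)"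
    unfolding conv_eq by (intro sum.cong refl) (auto simp: delta_def)
  also have "\<dots> = (\<Sum>a\<in>perms. if a = g \<circ> inv' \<sigma> then x a else 0)"
  proof (intro sum.cong refl)
    fix a
    have "a \<circ> \<sigma> = g \<longleftrightarrow> a = g \<circ> inv' \<sigma>"
      using permutes_inv_o[OF \<sigma>] by (metis comp_assoc comp_id)
    then show "(\<Sum>b\<in>perms. if b = \<sigma> then (if a \<circ> \<sigma> = g then x a else 0) else 0)
        = (if a = g \<circ> inv' \<sigma> then x a else 0)"
      using finite_perms \<sigma> by simp
  qed
  also have "\<dots> = x (g \<circ> inv' \<sigma>)"
    using finite_perms x by (auto simp: carrier_iff)
  finally show ?thesis .
qed

lemma delta_conv:
  assumes x: "x \<in> carrier A" and \<sigma>: "\<sigma> permutes {1..n}"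
  shows "(delta \<sigma> \<star> x) g = x (inv' \<sigma> \<circ> g)"
proof -
  have "(delta \<sigma> \<star> x) g = (\<Sum>a\<in>perms. if a = \<sigma> then (\<Sum>b\<in>perms. if \<sigma> \<circ> b = g then x b else 0) else 0)"
    unfolding conv_eq by (intro sum.cong refl) (auto simp: delta_def intro!: sum.cong sum.neutral)
  also have "\<dots> = (\<Sum>b\<in>perms. if \<sigma> \<circ> b = g then x b else 0)"
    using finite_perms \<sigma> by simp
  also have "\<dots> = (\<Sum>b\<in>perms. if b = inv' \<sigma> \<circ> g then x b else 0)"
  proof (intro sum.cong refl)
    fix b
    have "\<sigma> \<circ> b = g \<longleftrightarrow> b = inv' \<sigma> \<circ> g"
      using permutes_inv_o[OF \<sigma>] by (metis comp_assoc id_comp)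
    then show "(if \<sigma> \<circ> b = g then x b else 0) = (if b = inv' \<sigma> \<circ> g then x b else 0)" by simp
  qed
  also have "\<dots> = x (inv' \<sigma> \<circ> g)"
    using finite_perms x by (auto simp: carrier_iff)
  finally show ?thesis .
qed

lemma delta_delta:
  assumes "\<sigma> permutes {1..n}" "\<tau> permutes {1..n}"
  shows "delta \<sigma> \<star> delta \<tau> = delta (\<sigma> \<circ> \<tau>)"
proof
  fix g
  have "inv' \<sigma> \<circ> g = \<tau> \<longleftrightarrow> g = \<sigma> \<circ> \<tau>"
    using permutes_inv_o[OF assms(1)] by (metis comp_assoc id_comp)
  then show "(delta \<sigma> \<star> delta \<tau>) g = delta (\<sigma> \<circ> \<tau>) g"
    using assms by (simp add: delta_conv) (simp add: delta_def)
qed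

text \<open>Writes the middle factor as a combination of permutations, so that a triple product can
  be studied one \<open>\<sigma>\<close> at a time.\<close>

lemma conv_expand:
  "(x \<star> y \<star> z) g = (\<Sum>\<sigma>\<in>perms. y \<sigma> * (x \<star> delta \<sigma> \<star> z) g)"
proof -
  have *: "(x \<star> y) d = (\<Sum>\<sigma>\<in>perms. y \<sigma> * (x \<star> delta \<sigma>) d)" for d
  proof -
    have "(x \<star> delta \<sigma>) d = (\<Sum>a\<in>perms. if a \<circ> \<sigma> = d then x a else 0)" if "\<sigma> \<in> perms" for \<sigma>
    proof -
      have "(x \<star> delta \<sigma>) d = (\<Sum>a\<in>perms. \<Sum>b\<in>perms. if b = \<sigma> then (if a \<circ> \<sigma> = d then x a else 0) else 0)"
        unfolding conv_eq by (intro sum.cong refl) (auto simp: delta_def)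
      then show ?thesis using that finite_perms by simp
    qed
    then have "(\<Sum>\<sigma>\<in>perms. y \<sigma> * (x \<star> delta \<sigma>) d) = (\<Sum>\<sigma>\<in>perms. \<Sum>a\<in>perms. if a \<circ> \<sigma> = d then x a * y \<sigma> else 0)"
      by (intro sum.cong refl) (auto simp: sum_distrib_left intro!: sum.cong)
    then show ?thesis unfolding conv_eq[of x y] by (subst sum.swap) simp
  qed
  have "(x \<star> y \<star> z) g = (\<Sum>a\<in>perms. \<Sum>b\<in>perms. \<Sum>\<sigma>\<in>perms. if a \<circ> b = g then y \<sigma> * ((x \<star> delta \<sigma>) a * z b) else 0)"
    unfolding conv_eq[of "x \<star> y"] *
    by (intro sum.cong refl) (auto simp: sum_distrib_right mult.assoc intro!: sum.cong)
  also have "\<dots> = (\<Sum>\<sigma>\<in>perms. \<Sum>a\<in>perms. \<Sum>b\<in>perms. if a \<circ> b = g then y \<sigma> * ((x \<star> delta \<sigma>) a * z b) else 0)"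
    by (subst (2) sum.swap, subst sum.swap, rule refl)
  also have "\<dots> = (\<Sum>\<sigma>\<in>perms. y \<sigma> * (x \<star> delta \<sigma> \<star> z) g)"
    unfolding conv_eq[of _ z]
    by (intro sum.cong refl) (auto simp: sum_distrib_left intro!: sum.cong)
  finally show ?thesis .
qed

section \<open>Absorption of permutations by symmetrizers and antisymmetrizers\<close>

lemma antisymmetrizer_conv_delta:
  assumes "\<tau> \<in> label_stabilizer n f"
  shows "antisymmetrizer n f \<star> delta \<tau> = (\<lambda>g. of_int (sign \<tau>) * antisymmetrizer n f g)"
proof
  fix g
  have \<tau>: "\<tau> permutes {1..n}" using assms by (simp add: label_stabilizer_def)
  have "g \<circ> inv' \<tau> \<in> label_stabilizer n f \<longleftrightarrow> g \<in> label_stabilizer n f"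
    using label_stabilizer_comp[OF _ label_stabilizer_inv[OF assms], of g]
      label_stabilizer_comp[OF _ assms, of "g \<circ> inv' \<tau>"] permutes_inv_o[OF \<tau>]
    by (auto simp: comp_assoc)
  moreover have "sign (g \<circ> inv' \<tau>) = sign \<tau> * sign g" if "g \<in> label_stabilizer n f"
  proof -
    have "permutation g" "permutation \<tau>"
      using that \<tau> permutation_permutes by (auto simp: label_stabilizer_def)
    then show ?thesis by (simp add: sign_compose sign_inverse permutation_inverse)
  qed
  ultimately show "(antisymmetrizer n f \<star> delta \<tau>) g = of_int (sign \<tau>) * antisymmetrizer n f g"
    using \<tau> by (simp add: conv_delta) (simp add: antisymmetrizer_def)
qed

lemma delta_conv_symmetrizer:
  assumes "\<tau> \<in> label_stabilizer n f"
  shows "delta \<tau> \<star> symmetrizer n f = symmetrizer n f"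
proof
  fix g
  have \<tau>: "\<tau> permutes {1..n}" using assms by (simp add: label_stabilizer_def)
  have "inv' \<tau> \<circ> g \<in> label_stabilizer n f \<longleftrightarrow> g \<in> label_stabilizer n f"
    using label_stabilizer_comp[OF label_stabilizer_inv[OF assms], of g]
      label_stabilizer_comp[OF assms, of "inv' \<tau> \<circ> g"] permutes_inv_o[OF \<tau>]
    by (auto simp: comp_assoc[symmetric])
  then show "(delta \<tau> \<star> symmetrizer n f) g = symmetrizer n f g"
    using \<tau> by (simp add: delta_conv) (simp add: symmetrizer_def)
qed

text \<open>Two entries with equal labels on both sides give a transposition that is absorbed by the
  symmetrizer and, carried through \<open>\<sigma>\<close>, by the antisymmetrizer with sign \<open>-1\<close>.\<close>

lemma antisymmetrizer_delta_symmetrizer_zero: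
  assumes \<sigma>: "\<sigma> permutes {1..n}" and "\<not> inj_on (\<lambda>u. (f (\<sigma> u), g u)) {1..n}"
  shows "antisymmetrizer n f \<star> delta \<sigma> \<star> symmetrizer n g = \<zero>\<^bsub>A\<^esub>"
proof -
  obtain u v where uv: "u \<in> {1..n}" "v \<in> {1..n}" "u \<noteq> v" "f (\<sigma> u) = f (\<sigma> v)" "g u = g v"
    using assms(2) by (auto simp: inj_on_def)
  let ?t = "transpose u v" and ?s = "transpose (\<sigma> u) (\<sigma> v)"
  have t: "?t \<in> label_stabilizer n g"
    using uv by (auto simp: label_stabilizer_def permutes_swap_id transpose_def)
  have s: "?s \<in> label_stabilizer n f"
    using uv permutes_in_image[OF \<sigma>]
    by (auto simp: label_stabilizer_def permutes_swap_id transpose_def)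
  have p: "?t permutes {1..n}" "?s permutes {1..n}"
    using s t by (auto simp: label_stabilizer_def)
  have "?s \<circ> \<sigma> = \<sigma> \<circ> ?t"
    using permutes_inj[OF \<sigma>] by (auto simp: fun_eq_iff transpose_def inj_eq)
  then have comm: "delta ?s \<star> delta \<sigma> = delta \<sigma> \<star> delta ?t"
    using p \<sigma> by (simp add: delta_delta)
  have sgn: "sign ?s = -1"
    using uv(3) permutes_inj[OF \<sigma>] by (simp add: sign_swap_id inj_eq)
  let ?E = "antisymmetrizer n f \<star> delta \<sigma> \<star> symmetrizer n g"
  have "?E = antisymmetrizer n f \<star> (delta \<sigma> \<star> (delta ?t \<star> symmetrizer n g))"
    using t \<sigma> by (simp add: delta_conv_symmetrizer m_assoc)
  also have "\<dots> = antisymmetrizer n f \<star> delta ?s \<star> (delta \<sigma> \<star> symmetrizer n g)"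
    using p \<sigma> comm by (simp add: m_assoc[symmetric]) (simp add: m_assoc)
  also have "\<dots> = (\<lambda>h. - 1 * ?E h)"
    unfolding antisymmetrizer_conv_delta[OF s] sgn scale_conv
    using \<sigma> by (simp add: m_assoc)
  finally have "?E h = - ?E h" for h by (metis mult_minus1)
  then show ?thesis by (auto simp: zero_eq fun_eq_iff)
qed

section \<open>Triple products of symmetrizers and antisymmetrizers\<close>

lemma conv_middle:
  assumes "S \<subseteq> perms" "id \<in> S"
    and "\<And>\<sigma> x. \<sigma> \<in> perms \<Longrightarrow> b \<sigma> * (a \<star> delta \<sigma> \<star> c) x = (if \<sigma> \<in> S then (a \<star> c) x else 0)"
  obtains r where "r \<noteq> 0" "a \<star> b \<star> c = (\<lambda>x. r * (a \<star> c) x)"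
proof
  have "finite S" using assms(1) finite_perms by (rule finite_subset)
  \<comment> \<open>Each element of \<open>S\<close> contributes one copy of the product of
    \<open>a\<close> and \<open>c\<close> and all other permutations contribute nothing, so the
    multiple is \<open>card S\<close>.\<close>
  with \<open>id \<in> S\<close> show "of_nat (card S) \<noteq> (0::complex)" by auto
  show "a \<star> b \<star> c = (\<lambda>x. of_nat (card S) * (a \<star> c) x)"
  proof
    fix x
    have "(a \<star> b \<star> c) x = (\<Sum>\<sigma>\<in>perms. if \<sigma> \<in> S then (a \<star> c) x else 0)"
      unfolding conv_expand[of a b c] by (intro sum.cong refl assms(3))
    also have "\<dots> = (\<Sum>\<sigma>\<in>S. (a \<star> c) x)"
      using finite_perms assms(1) by (intro sum.mono_neutral_cong_right) auto
    finally show "(a \<star> b \<star> c) x = of_nat (card S) * (a \<star> c) x" by simp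
  qed
qed

text \<open>A term \<open>\<sigma>\<close> of the middle factor that violates injectivity vanishes;
  the others stabilize \<open>h\<close> and are absorbed on the right. When \<open>h\<close> arises
  from \<open>g\<close> by a move that keeps \<open>f\<close>, the assumption is
  \<open>stabilizer_move_label\<close>.\<close>

lemma antisymmetrizer_symmetrizer_symmetrizer:
  assumes "\<And>\<sigma>. \<sigma> \<in> label_stabilizer n g \<Longrightarrow> inj_on (\<lambda>u. (f (\<sigma> u), h u)) {1..n} \<Longrightarrow>
      \<sigma> \<in> label_stabilizer n h"
  obtains r where "r \<noteq> 0"
    "antisymmetrizer n f \<star> symmetrizer n g \<star> symmetrizer n h =
      (\<lambda>x. r * (antisymmetrizer n f \<star> symmetrizer n h) x)"
proof (rule conv_middle)
  show "label_stabilizer n g \<inter> label_stabilizer n h \<subseteq> perms"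
    "id \<in> label_stabilizer n g \<inter> label_stabilizer n h"
    by (auto simp: label_stabilizer_def permutes_id)
  fix \<sigma> x assume \<sigma>: "\<sigma> \<in> perms"
  show "symmetrizer n g \<sigma> * (antisymmetrizer n f \<star> delta \<sigma> \<star> symmetrizer n h) x =
      (if \<sigma> \<in> label_stabilizer n g \<inter> label_stabilizer n h
       then (antisymmetrizer n f \<star> symmetrizer n h) x else 0)"
  proof (cases "\<sigma> \<in> label_stabilizer n h")
    case True
    then show ?thesis using \<sigma> by (simp add: m_assoc delta_conv_symmetrizer) (simp add: symmetrizer_def)
  next
    case False
    then have "antisymmetrizer n f \<star> delta \<sigma> \<star> symmetrizer n h = \<zero>\<^bsub>A\<^esub>" if "\<sigma> \<in> label_stabilizer n g"
      using assms[OF that] antisymmetrizer_delta_symmetrizer_zero[of \<sigma> f h] \<sigma> by blast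
    with False show ?thesis by (simp add: symmetrizer_def zero_eq)
  qed
qed

text \<open>Here every term of the middle factor vanishes; \<open>staircase_conflict\<close>
  provides this situation for the lower summands of the filtration.\<close>

lemma antisymmetrizer_symmetrizer_symmetrizer_zero:
  assumes "\<And>\<sigma>. \<sigma> \<in> label_stabilizer n g \<Longrightarrow> \<not> inj_on (\<lambda>u. (f (\<sigma> u), h u)) {1..n}"
  shows "antisymmetrizer n f \<star> symmetrizer n g \<star> symmetrizer n h = \<zero>\<^bsub>A\<^esub>"
proof
  fix x
  have "symmetrizer n g \<sigma> * (antisymmetrizer n f \<star> delta \<sigma> \<star> symmetrizer n h) x = 0"
    if "\<sigma> \<in> perms" for \<sigma>
    using that assms antisymmetrizer_delta_symmetrizer_zero[of \<sigma> f h] by (auto simp: symmetrizer_def zero_eq)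
  then show "(antisymmetrizer n f \<star> symmetrizer n g \<star> symmetrizer n h) x = \<zero>\<^bsub>A\<^esub> x"
    unfolding conv_expand[of _ "symmetrizer n g"] zero_eq by (intro sum.neutral) blast
qed

text \<open>A surviving \<open>\<sigma>\<close> is now absorbed on the left, with a sign that
  cancels the one it carries in the middle factor. When \<open>f\<close> arises from
  \<open>g\<close> by a move that keeps \<open>h\<close>, the assumption is
  \<open>stabilizer_move_label'\<close>.\<close>

lemma antisymmetrizer_antisymmetrizer_symmetrizer:
  assumes "\<And>\<sigma>. \<sigma> \<in> label_stabilizer n g \<Longrightarrow> inj_on (\<lambda>u. (f (\<sigma> u), h u)) {1..n} \<Longrightarrow>
      \<sigma> \<in> label_stabilizer n f"
  obtains r where "r \<noteq> 0"
    "antisymmetrizer n f \<star> antisymmetrizer n g \<star> symmetrizer n h =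
      (\<lambda>x. r * (antisymmetrizer n f \<star> symmetrizer n h) x)"
proof (rule conv_middle)
  show "label_stabilizer n g \<inter> label_stabilizer n f \<subseteq> perms"
    "id \<in> label_stabilizer n g \<inter> label_stabilizer n f"
    by (auto simp: label_stabilizer_def permutes_id)
  fix \<sigma> x assume \<sigma>: "\<sigma> \<in> perms"
  show "antisymmetrizer n g \<sigma> * (antisymmetrizer n f \<star> delta \<sigma> \<star> symmetrizer n h) x =
      (if \<sigma> \<in> label_stabilizer n g \<inter> label_stabilizer n f
       then (antisymmetrizer n f \<star> symmetrizer n h) x else 0)"
  proof (cases "\<sigma> \<in> label_stabilizer n f")
    case True
    have "of_int (sign \<sigma>) * (of_int (sign \<sigma>) * y) = (y :: complex)" for y
      by (metis mult.assoc mult_1 of_int_1 of_int_mult sign_idempotent)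
    then show ?thesis using True
      by (simp add: antisymmetrizer_conv_delta scale_conv) (simp add: antisymmetrizer_def)
  next
    case False
    then have "antisymmetrizer n f \<star> delta \<sigma> \<star> symmetrizer n h = \<zero>\<^bsub>A\<^esub>" if "\<sigma> \<in> label_stabilizer n g"
      using assms[OF that] antisymmetrizer_delta_symmetrizer_zero[of \<sigma> f h] \<sigma> by blast
    with False show ?thesis by (simp add: antisymmetrizer_def zero_eq)
  qed
qed

section \<open>Left ideals generated by Young symmetrizers\<close>

lemma left_ideal_scale:
  assumes "c \<noteq> 0" "y \<in> carrier A"
  shows "left_ideal A (\<lambda>g. c * y g) = left_ideal A y"
proof -
  have sub: "left_ideal A (\<lambda>g. c * y g) \<subseteq> left_ideal A y" if y: "y \<in> carrier A" for c y
  proof -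
    have "(\<lambda>g. c * y g) = (\<lambda>g. c * \<one>\<^bsub>A\<^esub> g) \<star> y"
      unfolding scale_conv using y by (simp only: l_one)
    then show ?thesis
      using left_ideal_mult_subset[of "\<lambda>g. c * \<one>\<^bsub>A\<^esub> g" y] y by simp
  qed
  have "left_ideal A (\<lambda>g. (1 / c) * (c * y g)) \<subseteq> left_ideal A (\<lambda>g. c * y g)"
    by (rule sub) (use assms in auto)
  then show ?thesis using sub[OF assms(2), of c] assms(1) by simp
qed

text \<open>\<open>delta \<sigma>\<close> is a unit with inverse
  \<open>delta (inv' \<sigma>)\<close>, so each generator is a left multiple of the other.\<close>

lemma left_ideal_delta:
  assumes "\<sigma> permutes {1..n}" "y \<in> carrier A"
  shows "left_ideal A (delta \<sigma> \<star> y) = left_ideal A y"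
proof
  show "left_ideal A (delta \<sigma> \<star> y) \<subseteq> left_ideal A y"
    using assms by (intro left_ideal_mult_subset) auto
  have "delta (inv' \<sigma>) \<star> (delta \<sigma> \<star> y) = y"
    using assms permutes_inv[OF assms(1)] permutes_inv_o[OF assms(1)]
    by (simp add: m_assoc[symmetric] delta_delta one_eq[symmetric])
  then show "left_ideal A y \<subseteq> left_ideal A (delta \<sigma> \<star> y)"
    using left_ideal_mult_subset[of "delta (inv' \<sigma>)" "delta \<sigma> \<star> y"]
      assms permutes_inv[OF assms(1)] by simp
qed

text \<open>The permutation \<open>\<pi>\<close> compares the filling \<open>T\<close> with the
  numbering of the cells by \<open>1..n\<close>. The row and column groups of \<open>T\<close> are
  the conjugates by \<open>\<pi>\<close> of the label stabilizers. The bracketing isolates the left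
  factor \<open>delta \<pi>\<close>, which does not affect the left ideal.\<close>

lemma young_symmetrizer_labels:
  fixes \<rho> \<kappa> :: "nat \<Rightarrow> nat"
  assumes E: "E = (\<lambda>x. (\<rho> x, \<kappa> x)) ` {1..n}" "card E = n"
    and \<pi>: "\<pi> permutes {1..n}" "\<And>x. x \<in> {1..n} \<Longrightarrow> \<pi> x = T (\<rho> x, \<kappa> x)"
  shows "young_symmetrizer E T =
    delta \<pi> \<star> (antisymmetrizer n \<kappa> \<star> symmetrizer n \<rho> \<star> delta (inv' \<pi>))"
proof -
  note i = permutes_inv[OF \<pi>(1)] and io = permutes_inv_o[OF \<pi>(1)]
  have conj: "\<sigma> permutes {1..n} \<longleftrightarrow> inv' \<pi> \<circ> \<sigma> \<circ> \<pi> permutes {1..n}" for \<sigma>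
  proof
    assume h: "inv' \<pi> \<circ> \<sigma> \<circ> \<pi> permutes {1..n}"
    have "\<pi> \<circ> (inv' \<pi> \<circ> \<sigma> \<circ> \<pi>) \<circ> inv' \<pi> permutes {1..n}"
      by (rule permutes_compose[OF i permutes_compose[OF h \<pi>(1)]])
    also have "\<pi> \<circ> (inv' \<pi> \<circ> \<sigma> \<circ> \<pi>) \<circ> inv' \<pi> = (\<pi> \<circ> inv' \<pi>) \<circ> \<sigma> \<circ> (\<pi> \<circ> inv' \<pi>)"
      by (simp only: comp_assoc)
    finally show "\<sigma> permutes {1..n}" using io by simp
  qed (use i \<pi>(1) in \<open>intro permutes_compose\<close>)
  \<comment> \<open>Stated for an arbitrary coordinate \<open>s\<close>, to be used with
    \<open>fst\<close> for rows and \<open>snd\<close> for columns.\<close>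
  have grp: "(\<sigma> permutes {1..n} \<and> (\<forall>c\<in>E. \<forall>c'\<in>E. \<sigma> (T c) = T c' \<longrightarrow> s c' = s c)) \<longleftrightarrow>
      inv' \<pi> \<circ> \<sigma> \<circ> \<pi> \<in> label_stabilizer n (\<lambda>x. s (\<rho> x, \<kappa> x))" for \<sigma> and s :: "cell \<Rightarrow> nat"
  proof -
    have "(\<forall>c\<in>E. \<forall>c'\<in>E. \<sigma> (T c) = T c' \<longrightarrow> s c' = s c) \<longleftrightarrow>
        (\<forall>x\<in>{1..n}. s (\<rho> (inv' \<pi> (\<sigma> (\<pi> x))), \<kappa> (inv' \<pi> (\<sigma> (\<pi> x)))) = s (\<rho> x, \<kappa> x))"
      if \<sigma>: "\<sigma> permutes {1..n}"
    proof -
      have "(\<forall>c\<in>E. \<forall>c'\<in>E. \<sigma> (T c) = T c' \<longrightarrow> s c' = s c) \<longleftrightarrow>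
        (\<forall>x\<in>{1..n}. \<forall>y\<in>{1..n}. \<sigma> (\<pi> x) = \<pi> y \<longrightarrow> s (\<rho> y, \<kappa> y) = s (\<rho> x, \<kappa> x))"
        unfolding E(1) by (simp add: \<pi>(2))
      also have "\<dots> \<longleftrightarrow> (\<forall>x\<in>{1..n}. \<forall>y\<in>{1..n}. y = inv' \<pi> (\<sigma> (\<pi> x)) \<longrightarrow> s (\<rho> y, \<kappa> y) = s (\<rho> x, \<kappa> x))"
        using permutes_inverses[OF \<pi>(1)] by metis
      also have "\<dots> \<longleftrightarrow> (\<forall>x\<in>{1..n}. s (\<rho> (inv' \<pi> (\<sigma> (\<pi> x))), \<kappa> (inv' \<pi> (\<sigma> (\<pi> x)))) = s (\<rho> x, \<kappa> x))"
      proof -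
        have "inv' \<pi> (\<sigma> (\<pi> x)) \<in> {1..n}" if "x \<in> {1..n}" for x
          using that by (simp only: permutes_in_image[OF i] permutes_in_image[OF \<sigma>] permutes_in_image[OF \<pi>(1)])
        then show ?thesis by blast
      qed
      finally show ?thesis .
    qed
    then show ?thesis using conj[of \<sigma>] by (auto simp: label_stabilizer_def)
  qed
  have row: "\<sigma> \<in> row_group E T \<longleftrightarrow> inv' \<pi> \<circ> \<sigma> \<circ> \<pi> \<in> label_stabilizer n \<rho>" for \<sigma>
    using grp[of \<sigma> fst] by (simp add: row_group_def E(2) sym_group_def)
  have col: "\<sigma> \<in> col_group E T \<longleftrightarrow> inv' \<pi> \<circ> \<sigma> \<circ> \<pi> \<in> label_stabilizer n \<kappa>" for \<sigma>
    using grp[of \<sigma> snd] by (simp add: col_group_def E(2) sym_group_def)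
  have conj_eq: "(delta \<pi> \<star> x \<star> delta (inv' \<pi>)) g = x (inv' \<pi> \<circ> g \<circ> \<pi>)" if "x \<in> carrier A" for x g
    using that \<pi>(1) i by (simp add: conv_delta delta_conv permutes_inv_inv comp_assoc)
  define a where "a = delta \<pi> \<star> antisymmetrizer n \<kappa> \<star> delta (inv' \<pi>)"
  define r where "r = delta \<pi> \<star> symmetrizer n \<rho> \<star> delta (inv' \<pi>)"
  have a: "a \<sigma> = (if \<sigma> \<in> col_group E T then of_int (sign \<sigma>) else 0)" if \<sigma>: "\<sigma> permutes {1..n}" for \<sigma>
  proof -
    have "permutation \<sigma>" "permutation \<pi>" "permutation (inv' \<pi>)"
      using \<sigma> \<pi>(1) i permutation_permutes by auto
    then have "sign (inv' \<pi> \<circ> \<sigma> \<circ> \<pi>) = sign \<sigma> * (sign \<pi> * sign \<pi>)"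
      by (simp add: sign_compose sign_inverse permutation_compose del: sign_idempotent)
    then show ?thesis
      unfolding a_def by (simp add: conj_eq col) (simp add: antisymmetrizer_def)
  qed
  have r: "r \<sigma> = (if \<sigma> \<in> row_group E T then 1 else 0)" for \<sigma>
    unfolding r_def by (simp add: conj_eq row) (simp add: symmetrizer_def)
  have sub: "row_group E T \<subseteq> perms" "col_group E T \<subseteq> perms"
    by (auto simp: row_group_def col_group_def E(2) sym_group_def)
  have "young_symmetrizer E T g = (a \<star> r) g" for g
  proof -
    \<comment> \<open>The Young symmetrizer has the sum over row permutations outside, the
      convolution the one over column permutations; hence the swap.\<close>
    have "(a \<star> r) g = (\<Sum>b\<in>perms. \<Sum>c\<in>perms. if c \<circ> b = g then a c * r b else 0)"
      unfolding conv_eq by (rule sum.swap)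
    also have "\<dots> = (\<Sum>b\<in>row_group E T. \<Sum>c\<in>perms. if c \<circ> b = g then a c * r b else 0)"
      using sub finite_perms by (intro sum.mono_neutral_right) (auto simp: r intro!: sum.neutral)
    also have "\<dots> = (\<Sum>b\<in>row_group E T. \<Sum>c\<in>col_group E T. if c \<circ> b = g then a c * r b else 0)"
      using sub finite_perms by (intro sum.cong refl sum.mono_neutral_right) (auto simp: a)
    also have "\<dots> = young_symmetrizer E T g"
      unfolding young_symmetrizer_def using sub by (intro sum.cong refl) (auto simp: a r)
    finally show ?thesis by simp
  qed
  then have "young_symmetrizer E T = a \<star> r" by auto
  also have "\<dots> = delta \<pi> \<star> (antisymmetrizer n \<kappa> \<star> (delta (inv' \<pi>) \<star> delta \<pi>) \<star> symmetrizer n \<rho> \<star> delta (inv' \<pi>))"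
    unfolding a_def r_def using \<pi>(1) i by (simp add: m_assoc)
  also have "delta (inv' \<pi>) \<star> delta \<pi> = \<one>\<^bsub>A\<^esub>"
    using \<pi>(1) i io by (simp add: delta_delta one_eq)
  finally show ?thesis by (simp add: m_assoc)
qed

end

section \<open>The filtration\<close>

text \<open>Numbering the cells and then applying the filling gives a bijection of
  \<open>{1..n}\<close>; fixing all other numbers makes it a permutation.\<close>

lemma filling_permutation:
  assumes "inj_on (\<lambda>x. (\<rho> x, \<kappa> x)) {1..n}" "E = (\<lambda>x. (\<rho> x, \<kappa> x)) ` {1..n}" "filling E T"
  obtains \<pi> where "\<pi> permutes {1..n}" "\<And>x. x \<in> {1..n} \<Longrightarrow> \<pi> x = T (\<rho> x, \<kappa> x)"
proof
  define \<pi> where "\<pi> x = (if x \<in> {1..n} then T (\<rho> x, \<kappa> x) else x)" for x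
  have "card E = n" using assms(1,2) by (simp add: card_image)
  then have "bij_betw (T \<circ> (\<lambda>x. (\<rho> x, \<kappa> x))) {1..n} {1..n}"
    using assms by (intro bij_betw_trans[of _ _ E]) (auto simp: filling_def bij_betw_def)
  then have "bij_betw \<pi> {1..n} {1..n}"
    by (rule bij_betw_cong[THEN iffD1, rotated]) (simp add: \<pi>_def)
  then show "\<pi> permutes {1..n}"
    by (rule bij_imp_permutes) (auto simp: \<pi>_def)
  show "\<pi> x = T (\<rho> x, \<kappa> x)" if "x \<in> {1..n}" for x
    using that by (simp add: \<pi>_def)
qed

text \<open>Of the two conjugating factors only the left one disappears in a left ideal. The right
  one stays and is later built into the surjection.\<close>

lemma (in symmetric_group_algebra) specht_module_labels:
  fixes \<rho> \<kappa> :: "nat \<Rightarrow> nat"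
  assumes E: "E = (\<lambda>x. (\<rho> x, \<kappa> x)) ` {1..n}" "card E = n"
    and \<pi>: "\<pi> permutes {1..n}" "\<And>x. x \<in> {1..n} \<Longrightarrow> \<pi> x = T (\<rho> x, \<kappa> x)"
  shows "specht_module E T = (left_regular_module A)
    \<lparr>carrier := left_ideal A (antisymmetrizer n \<kappa> \<star> symmetrizer n \<rho> \<star> delta (inv' \<pi>))\<rparr>"
proof -
  have "specht_module E T = (left_regular_module A)\<lparr>carrier := left_ideal A (young_symmetrizer E T)\<rparr>"
    by (simp add: specht_module_def E(2) left_ideal_def)
  moreover have "left_ideal A (young_symmetrizer E T) =
      left_ideal A (antisymmetrizer n \<kappa> \<star> symmetrizer n \<rho> \<star> delta (inv' \<pi>))"
    using \<pi>(1) permutes_inv[OF \<pi>(1)]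
    by (subst young_symmetrizer_labels[OF E \<pi>]) (auto intro!: left_ideal_delta)
  ultimately show ?thesis by simp
qed

theorem theorem3p5:
  fixes D :: "cell set" and T :: "cell \<Rightarrow> nat" and p :: nat
  assumes "p \<ge> 1"
    and "diagram D"
    and "contains_staircase_dot_one p D"
    and "filling D T"
  shows "\<exists>M :: nat \<Rightarrow> ((nat \<Rightarrow> nat) \<Rightarrow> complex) set.
    M 0 = {\<zero>\<^bsub>specht_module D T\<^esub>} \<and>
    M p = carrier (specht_module D T) \<and>
    (\<forall>j\<in>{0..p}. submodule (M j) (sym_algebra (card D)) (specht_module D T)) \<and>
    (\<forall>j\<in>{1..p}. M (j - 1) \<subseteq> M j) \<and>
    (\<forall>j\<in>{1..p}. \<forall>T'. filling (row_move p (p - j + 1) (col_move p j D)) T' \<longrightarrow>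
      (\<exists>f. module_surjection (sym_algebra (card D))
             (quotient_module ((specht_module D T)\<lparr>carrier := M j\<rparr>) (M (j - 1)))
             (specht_module (row_move p (p - j + 1) (col_move p j D)) T') f))"
proof -
  define n where "n = card D"
  interpret symmetric_group_algebra n .
  let ?A = "sym_algebra n" and ?N = "{1..n}"
  have bij: "bij_betw T D ?N" using \<open>filling D T\<close> by (simp add: filling_def n_def)
  \<comment> \<open>The cells are numbered by \<open>T\<close> itself, so that for \<open>D\<close>
    the comparing permutation is the identity.\<close>
  define \<rho> where "\<rho> x = fst (inv_into D T x)" for x
  define \<kappa> where "\<kappa> x = snd (inv_into D T x)" for x
  have cell: "(\<rho> x, \<kappa> x) = inv_into D T x" for x by (simp add: \<rho>_def \<kappa>_def)
  have D: "D = (\<lambda>x. (\<rho> x, \<kappa> x)) ` ?N" and inj: "inj_on (\<lambda>x. (\<rho> x, \<kappa> x)) ?N"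
    using bij_betw_inv_into[OF bij] unfolding cell by (auto simp: bij_betw_def)
  \<comment> \<open>\<open>\<kappa>' i\<close> gives the columns after the column move, the rows
    being still \<open>\<rho>\<close>; \<open>\<eta> j\<close> gives the rows after the subsequent
    row move, the columns being still \<open>\<kappa>' j\<close>.\<close>
  define \<kappa>' where "\<kappa>' i = move_label ?N \<rho> \<kappa> p i" for i
  define \<eta> where "\<eta> j = move_label ?N (\<kappa>' j) \<rho> p (p - j + 1)" for j
  define y where "y i = antisymmetrizer n (\<kappa>' i) \<otimes>\<^bsub>?A\<^esub> symmetrizer n \<rho>" for i
  define M where "M = partial_sum ?A (\<lambda>i. left_ideal ?A (y i))"
  have y_carrier: "y i \<in> carrier ?A" for i by (simp add: y_def)
  have sub_N: "submodule (left_ideal ?A (y i)) ?A (left_regular_module ?A)" for i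
    by (rule left_ideal_submodule[OF y_carrier])
  have sub_M: "submodule (M j) ?A (left_regular_module ?A)" for j
    unfolding M_def by (rule partial_sum_submodule[OF sub_N])
  have "\<kappa>' p = \<kappa>" by (auto simp: \<kappa>'_def move_label_def)
  have specht: "specht_module D T = (left_regular_module ?A)\<lparr>carrier := left_ideal ?A (y p)\<rparr>"
  proof -
    have "id x = T (\<rho> x, \<kappa> x)" if "x \<in> ?N" for x
      using bij_betw_inv_into_right[OF bij that] by (simp add: cell)
    from specht_module_labels[OF D n_def[symmetric] permutes_id this] show ?thesis
      by (simp add: y_def \<open>\<kappa>' p = \<kappa>\<close> one_eq[unfolded id_def, symmetric])
  qed
  have step: "M (j - 1) \<subseteq> M j" "left_ideal ?A (y j) \<subseteq> M j" if "j \<in> {1..p}" for j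
    using that partial_sum_Suc_supset[of "j - 1" "\<lambda>i. left_ideal ?A (y i)", OF sub_N]
    by (auto simp: M_def)
  have N_subset: "left_ideal ?A (y i) \<subseteq> left_ideal ?A (y p)" for i
  proof -
    \<comment> \<open>This is the condition under which multiplying \<open>y p\<close> from the left
      by \<open>antisymmetrizer n (\<kappa>' i)\<close> yields a nonzero multiple of
      \<open>y i\<close>.\<close>
    have "\<sigma> \<in> label_stabilizer n (\<kappa>' i)"
      if "\<sigma> \<in> label_stabilizer n \<kappa>" "inj_on (\<lambda>u. (\<kappa>' i (\<sigma> u), \<rho> u)) ?N" for \<sigma>
      using that unfolding \<kappa>'_def by (rule stabilizer_move_label')
    from antisymmetrizer_antisymmetrizer_symmetrizer[OF this]
    obtain c where c: "c \<noteq> 0" "antisymmetrizer n (\<kappa>' i) \<otimes>\<^bsub>?A\<^esub> antisymmetrizer n \<kappa> \<otimes>\<^bsub>?A\<^esub>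
        symmetrizer n \<rho> = (\<lambda>x. c * y i x)"
      unfolding y_def by blast
    have "left_ideal ?A (y i) = left_ideal ?A (antisymmetrizer n (\<kappa>' i) \<otimes>\<^bsub>?A\<^esub> y p)"
      using left_ideal_scale[OF c(1) y_carrier, of i] c(2)
      by (simp add: y_def \<open>\<kappa>' p = \<kappa>\<close> m_assoc)
    then show ?thesis
      using left_ideal_mult_subset[of "antisymmetrizer n (\<kappa>' i)" "y p"] y_carrier by simp
  qed
  have M_subset: "M j \<subseteq> left_ideal ?A (y p)" for j
    unfolding M_def by (rule partial_sum_subset[OF N_subset sub_N])
  have surj: "\<exists>f. module_surjection ?A (quotient_module ((left_regular_module ?A)\<lparr>carrier := M j\<rparr>) (M (j - 1)))
      (specht_module (row_move p (p - j + 1) (col_move p j D)) T') f"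
    if j: "j \<in> {1..p}" and T': "filling (row_move p (p - j + 1) (col_move p j D)) T'" for j T'
  proof -
    let ?E = "row_move p (p - j + 1) (col_move p j D)"
    have E: "?E = (\<lambda>x. (\<eta> j x, \<kappa>' j x)) ` ?N"
      unfolding \<eta>_def by (rule row_move_labels) (simp only: col_move_labels[OF D] \<kappa>'_def)
    \<comment> \<open>Injectivity is carried through both moves; the coordinates are exchanged in
      between because \<open>inj_on_move_label\<close> changes the second one.\<close>
    have "inj_on (\<lambda>x. (\<rho> x, \<kappa>' j x)) ?N"
      unfolding \<kappa>'_def by (rule inj_on_move_label[OF inj])
    then have "inj_on (\<lambda>x. (\<kappa>' j x, \<rho> x)) ?N"
      unfolding inj_on_def prod.inject by blast
    then have "inj_on (\<lambda>x. (\<kappa>' j x, \<eta> j x)) ?N"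
      unfolding \<eta>_def by (rule inj_on_move_label)
    then have inj_E: "inj_on (\<lambda>x. (\<eta> j x, \<kappa>' j x)) ?N"
      unfolding inj_on_def prod.inject by blast
    then have card_E: "card ?E = n" unfolding E by (simp add: card_image)
    obtain \<pi> where \<pi>: "\<pi> permutes ?N" "\<And>x. x \<in> ?N \<Longrightarrow> \<pi> x = T' (\<eta> j x, \<kappa>' j x)"
      using filling_permutation[OF inj_E E T'] by blast
    let ?d = "delta (inv' \<pi>)"
    have d: "?d \<in> carrier ?A" using permutes_inv[OF \<pi>(1)] by simp
    \<comment> \<open>The factor \<open>?d\<close> makes the image equal to the Specht module for
      the given filling \<open>T'\<close>, rather than merely isomorphic to it.\<close>
    let ?c = "symmetrizer n (\<eta> j) \<otimes>\<^bsub>?A\<^esub> ?d"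
    have c: "?c \<in> carrier ?A" using d by simp
    let ?z = "antisymmetrizer n (\<kappa>' j) \<otimes>\<^bsub>?A\<^esub> symmetrizer n (\<eta> j) \<otimes>\<^bsub>?A\<^esub> ?d"
    have specht_E: "specht_module ?E T' = (left_regular_module ?A)\<lparr>carrier := left_ideal ?A ?z\<rparr>"
      by (rule specht_module_labels[OF E card_E \<pi>])
    \<comment> \<open>All summands of \<open>M (j - 1)\<close> have index below \<open>j\<close>,
      which is the situation of \<open>staircase_conflict\<close>.\<close>
    have ann: "x \<otimes>\<^bsub>?A\<^esub> ?c = \<zero>\<^bsub>?A\<^esub>" if "x \<in> M (j - 1)" for x
    proof (rule partial_sum_annihilated[OF _ sub_N c that[unfolded M_def]])
      fix i v assume i: "i \<in> {1..j - 1}" and "v \<in> left_ideal ?A (y i)"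
      then obtain x where x: "x \<in> carrier ?A" "v = x \<otimes>\<^bsub>?A\<^esub> y i" by (auto simp: left_ideal_def)
      have "y i \<otimes>\<^bsub>?A\<^esub> symmetrizer n (\<eta> j) = \<zero>\<^bsub>?A\<^esub>"
        unfolding y_def
      proof (rule antisymmetrizer_symmetrizer_symmetrizer_zero)
        fix \<sigma> assume \<sigma>: "\<sigma> \<in> label_stabilizer n \<rho>"
        show "\<not> inj_on (\<lambda>u. (\<kappa>' i (\<sigma> u), \<eta> j u)) ?N"
          unfolding \<eta>_def \<kappa>'_def
          by (rule staircase_conflict[OF assms(3)[unfolded D] _ _ _ \<sigma>]) (use i j in auto)
      qed
      then have "x \<otimes>\<^bsub>?A\<^esub> (y i \<otimes>\<^bsub>?A\<^esub> symmetrizer n (\<eta> j)) \<otimes>\<^bsub>?A\<^esub> ?d = \<zero>\<^bsub>?A\<^esub>" using x d by simp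
      then show "v \<otimes>\<^bsub>?A\<^esub> ?c = \<zero>\<^bsub>?A\<^esub>" using x d y_carrier by (simp add: m_assoc)
    qed
    have "(\<lambda>v. v \<otimes>\<^bsub>?A\<^esub> ?c) ` left_ideal ?A (y j) = left_ideal ?A ?z"
    proof -
      have "\<sigma> \<in> label_stabilizer n (\<eta> j)"
        if "\<sigma> \<in> label_stabilizer n \<rho>" "inj_on (\<lambda>u. (\<kappa>' j (\<sigma> u), \<eta> j u)) ?N" for \<sigma>
        using that unfolding \<eta>_def by (rule stabilizer_move_label)
      from antisymmetrizer_symmetrizer_symmetrizer[OF this]
      obtain r where r: "r \<noteq> 0" "y j \<otimes>\<^bsub>?A\<^esub> symmetrizer n (\<eta> j)
          = (\<lambda>x. r * (antisymmetrizer n (\<kappa>' j) \<otimes>\<^bsub>?A\<^esub> symmetrizer n (\<eta> j)) x)"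
        unfolding y_def by blast
      have "y j \<otimes>\<^bsub>?A\<^esub> ?c = (\<lambda>x. r * ?z x)"
        using r(2) d y_carrier by (simp add: m_assoc[symmetric] scale_conv)
      then show ?thesis
        using image_left_ideal[OF y_carrier c] left_ideal_scale[OF r(1), of ?z] d by simp
    qed
    \<comment> \<open>An element of \<open>M j\<close> is a sum of one from
      \<open>M (j - 1)\<close>, which is annihilated, and one from the last summand; so that summand
      already gives the whole image.\<close>
    moreover have "(\<lambda>v. v \<otimes>\<^bsub>?A\<^esub> ?c) ` M j = (\<lambda>v. v \<otimes>\<^bsub>?A\<^esub> ?c) ` left_ideal ?A (y j)"
    proof
      show "(\<lambda>v. v \<otimes>\<^bsub>?A\<^esub> ?c) ` M j \<subseteq> (\<lambda>v. v \<otimes>\<^bsub>?A\<^esub> ?c) ` left_ideal ?A (y j)"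
      proof (rule image_subsetI)
        fix v assume "v \<in> M j"
        then have "v \<in> partial_sum ?A (\<lambda>i. left_ideal ?A (y i)) (Suc (j - 1))"
          using j by (simp add: M_def)
        then obtain u w where uw: "u \<in> M (j - 1)" "w \<in> left_ideal ?A (y j)" "v = u \<oplus>\<^bsub>?A\<^esub> w"
          using j by (auto simp: M_def set_add_def')
        then have "u \<in> carrier ?A" "w \<in> carrier ?A"
          using submodule_left_regularD(1)[OF sub_M] submodule_left_regularD(1)[OF sub_N] by blast+
        then have "v \<otimes>\<^bsub>?A\<^esub> ?c = w \<otimes>\<^bsub>?A\<^esub> ?c" using uw c ann by (simp add: l_distr)
        then show "v \<otimes>\<^bsub>?A\<^esub> ?c \<in> (\<lambda>v. v \<otimes>\<^bsub>?A\<^esub> ?c) ` left_ideal ?A (y j)" using uw(2) by blast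
      qed
      show "(\<lambda>v. v \<otimes>\<^bsub>?A\<^esub> ?c) ` left_ideal ?A (y j) \<subseteq> (\<lambda>v. v \<otimes>\<^bsub>?A\<^esub> ?c) ` M j"
        using step(2)[OF j] by (rule image_mono)
    qed
    ultimately have "(\<lambda>v. v \<otimes>\<^bsub>?A\<^esub> ?c) ` M j = left_ideal ?A ?z" by simp
    then show ?thesis
      unfolding specht_E
      using quotient_module_surjection[OF sub_M sub_M c ann] by blast
  qed
  show ?thesis
  proof (rule exI[of _ M], intro conjI ballI allI impI)
    show "M 0 = {\<zero>\<^bsub>specht_module D T\<^esub>}"
      by (simp add: M_def specht left_regular_module_def)
    show "M p = carrier (specht_module D T)"
      \<comment> \<open>Because \<open>p \<ge> 1\<close>, the ideal generated by \<open>y p\<close>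
        is one of the summands of \<open>M p\<close>.\<close>
      using M_subset[of p] step(2)[of p] \<open>p \<ge> 1\<close> by (auto simp: specht)
    show "submodule (M j) (sym_algebra (card D)) (specht_module D T)" for j
      unfolding specht n_def[symmetric]
      by (rule submodule_left_regular_restrict[OF sub_M sub_N M_subset])
  next
    fix j assume "j \<in> {1..p}"
    then show "M (j - 1) \<subseteq> M j" by (rule step)
  next
    fix j T' assume "j \<in> {1..p}" "filling (row_move p (p - j + 1) (col_move p j D)) T'"
    then show "\<exists>f. module_surjection (sym_algebra (card D))
        (quotient_module ((specht_module D T)\<lparr>carrier := M j\<rparr>) (M (j - 1)))
        (specht_module (row_move p (p - j + 1) (col_move p j D)) T') f"
      using surj by (simp add: specht n_def[symmetric])
  qed
qed

end
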